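(* Let $n\ge1$ and $P,Q\in\mathcal P(w_0^{(n+1)})$. If $\mathrm{ind}_\delta(P)=\mathrm{ind}_\delta(Q)$ for all $\delta\in\{\mathsf A,\mathsf D\}^{n-1}$, then $P\sim Q$.
   Context: Let $\mathfrak{S}_{n+1}$ be the symmetric group on $[n+1]$, $s_i=(i,i+1)$. A word $(i_1,\dots,i_r)$ of $w$ ($w=s_{i_1}\cdots s_{i_r}$) is reduced if $r$ is minimal; $\mathscr{R}(w)$ is the set of reduced words. $w_0^{(n+1)}$ is the longest element of $\mathfrak S_{n+1}$. A word poset is a finite poset $P$ with a function $f_P:P\to\mathbb{Z}_{>0}$ ($x$ is "in column $f_P(x)$"); $P\sim Q$ if there is a poset isomorphism $\phi$ with $f_Q\circ\phi=f_P$. For $\mathbf i=(i_1,\dots,i_\ell)\in\mathscr R(w)$, $P_{\mathbf i}$ is the poset on $[\ell]$ generated (reflexive transitive closure) by $j<k$ for $j<k$ with $|i_j-i_k|=1$, with $f_{P_{\mathbf i}}(j)=i_j$. $\mathcal P(w)$ is the set of word posets isomorphic to some $P_{\mathbf i}$, $\mathbf i\in\mathscr R(w)$. For $P\in\mathcal P(w_0^{(n+1)})$ there is a unique chain $\mathsf D(P)=\{d_1<_P\cdots<_P d_n\}$ with $f_P(d_i)=n+1-i$ and a unique chain $\mathsf A(P)=\{a_1<_P\cdots<_P a_n\}$ with $f_P(a_i)=i$. Define $\mathrm{ind}_{\mathsf D}(P)=\sum_i\#\{k: k>_P d_i,\ f_P(k)=f_P(d_i)\}$ and $\mathrm{ind}_{\mathsf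 A}(P)=\sum_i\#\{k: k>_P a_i,\ f_P(k)=f_P(a_i)\}$. Let $I_{\mathsf D}(P)=\{k: k<_P d_i,\ f_P(k)=f_P(d_i)\text{ for some } i\}$, $I_{\mathsf A}(P)=\{k: k<_P a_i,\ f_P(k)=f_P(a_i)\text{ for some }i\}$. $C_{\mathsf D}(P)$ is $P\setminus\mathsf D(P)$ with induced order and $f_{C_{\mathsf D}(P)}(k)=f_P(k)$ for $k\in I_{\mathsf D}(P)$, $f_P(k)-1$ otherwise; $C_{\mathsf A}(P)$ is $P\setminus\mathsf A(P)$ with induced order and $f_{C_{\mathsf A}(P)}(k)=f_P(k)-1$ for $k\in I_{\mathsf A}(P)$, $f_P(k)$ otherwise. Both lie in $\mathcal P(w_0^{(n)})$. For $\delta=(\delta_1,\dots,\delta_{n-1})\in\{\mathsf A,\mathsf D\}^{n-1}$, $\mathrm{ind}_\delta(P)=(I_1,\dots,I_{n-1})$ where $I_k=\mathrm{ind}_{\delta_k}(C_{\delta_{k+1}}\circ\cdots\circ C_{\delta_{n-1}}(P))$. *)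

theory Defs
  imports "HOL-Combinatorics.Permutations"
begin

section \<open>Reduced words in the symmetric group on \<open>{1..m}\<close>\<close>

text \<open>The empty word gives the identity, and \<open>s\<^sub>i\<close> with \<open>1 \<le> i < m\<close> swaps \<open>i\<close> and \<open>i + 1\<close>.
  Products are compositions of functions, as usual: the rightmost letter acts first.\<close>

definition word_perm :: "nat list \<Rightarrow> nat \<Rightarrow> nat" where
  "word_perm is = foldr (\<lambda>i p. Transposition.transpose i (i + 1) \<circ> p) is id"

definition words :: "nat \<Rightarrow> (nat \<Rightarrow> nat) \<Rightarrow> nat list set" where
  "words m w = {is. set is \<subseteq> {1..<m} \<and> word_perm is = w}"

definition perm_length :: "nat \<Rightarrow> (nat \<Rightarrow> nat) \<Rightarrow> nat" where
  "perm_length m w = (LEAST r. \<exists>is \<in> words m w. length is = r)"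

definition reduced_words :: "nat \<Rightarrow> (nat \<Rightarrow> nat) \<Rightarrow> nat list set" where
  "reduced_words m w = {is \<in> words m w. length is = perm_length m w}"

definition longest_perm :: "nat \<Rightarrow> nat \<Rightarrow> nat" where
  "longest_perm m = (THE w. w permutes {1..m} \<and>
     (\<forall>v. v permutes {1..m} \<longrightarrow> perm_length m v \<le> perm_length m w))"


section \<open>Word posets\<close>

record 'a word_poset =
  elts :: "'a set"
  leq :: "('a \<times> 'a) set"
  col :: "'a \<Rightarrow> nat"

definition word_poset :: "'a word_poset \<Rightarrow> bool" where
  "word_poset P \<longleftrightarrow> finite (elts P) \<and> partial_order_on (elts P) (leq P) \<and> (\<forall>x \<in> elts P. 0 < col P x)"

definition less_in :: "'a word_poset \<Rightarrow> 'a \<Rightarrow> 'a \<Rightarrow> bool" where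
  "less_in P x y \<longleftrightarrow> (x, y) \<in> leq P \<and> x \<noteq> y"

definition wp_iso :: "'a word_poset \<Rightarrow> 'b word_poset \<Rightarrow> bool" (infix "\<sim>" 50) where
  "P \<sim> Q \<longleftrightarrow> (\<exists>\<phi>. bij_betw \<phi> (elts P) (elts Q) \<and>
     (\<forall>x \<in> elts P. \<forall>y \<in> elts P. (x, y) \<in> leq P \<longleftrightarrow> (\<phi> x, \<phi> y) \<in> leq Q) \<and>
     (\<forall>x \<in> elts P. col Q (\<phi> x) = col P x))"

text \<open>Positions of a word are numbered from 1, whereas \<open>(!)\<close> counts from 0.\<close>

definition poset_of_word :: "nat list \<Rightarrow> nat word_poset" where
  "poset_of_word is =
    \<lparr> elts = {1..length is},
      leq = {(j, k). 1 \<le> j \<and> j < k \<and> k \<le> length is \<and>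
               \<bar>int (is ! (j - 1)) - int (is ! (k - 1))\<bar> = 1}\<^sup>* \<inter> {1..length is} \<times> {1..length is},
      col = (\<lambda>j. is ! (j - 1)) \<rparr>"

definition word_posets :: "nat \<Rightarrow> (nat \<Rightarrow> nat) \<Rightarrow> 'a word_poset set" where
  "word_posets m w = {P. word_poset P \<and> (\<exists>is \<in> reduced_words m w. P \<sim> poset_of_word is)}"


section \<open>Indices and contractions\<close>

text \<open>\<open>Asc\<close> and \<open>Desc\<close> stand for the letters \<open>A\<close> and \<open>D\<close>. In the following definitions \<open>n\<close> is such
  that \<open>P\<close> belongs to the longest element of the symmetric group on \<open>{1..n + 1}\<close>.\<close>

datatype dir = Asc | Desc

fun chain_col :: "nat \<Rightarrow> dir \<Rightarrow> nat \<Rightarrow> nat" where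
  "chain_col n Asc i = i"
| "chain_col n Desc i = n + 1 - i"

definition dir_chain :: "nat \<Rightarrow> dir \<Rightarrow> 'a word_poset \<Rightarrow> 'a set" where
  "dir_chain n d P = (THE S. \<exists>c. S = c ` {1..n} \<and>
     (\<forall>i \<in> {1..n}. c i \<in> elts P \<and> col P (c i) = chain_col n d i) \<and>
     (\<forall>i \<in> {1..n}. \<forall>j \<in> {1..n}. i < j \<longrightarrow> less_in P (c i) (c j)))"

definition ind :: "nat \<Rightarrow> dir \<Rightarrow> 'a word_poset \<Rightarrow> nat" where
  "ind n d P = (\<Sum>x \<in> dir_chain n d P. card {k \<in> elts P. less_in P x k \<and> col P k = col P x})"

definition below_chain :: "nat \<Rightarrow> dir \<Rightarrow> 'a word_poset \<Rightarrow> 'a set" where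
  "below_chain n d P =
    {k \<in> elts P. \<exists>x \<in> dir_chain n d P. less_in P k x \<and> col P k = col P x}"

fun new_col :: "nat \<Rightarrow> dir \<Rightarrow> 'a word_poset \<Rightarrow> 'a \<Rightarrow> nat" where
  "new_col n Desc P k = (if k \<in> below_chain n Desc P then col P k else col P k - 1)"
| "new_col n Asc P k = (if k \<in> below_chain n Asc P then col P k - 1 else col P k)"

definition contract :: "nat \<Rightarrow> dir \<Rightarrow> 'a word_poset \<Rightarrow> 'a word_poset" where
  "contract n d P =
    (let E = elts P - dir_chain n d P
     in \<lparr> elts = E, leq = leq P \<inter> E \<times> E, col = new_col n d P \<rparr>)"

text \<open>The list \<open>\<delta>\<close> is \<open>(\<delta>\<^sub>1, \<dots>, \<delta>\<^sub>n\<^sub>-\<^sub>1)\<close>, so \<open>\<delta>\<^sub>k\<close> is \<open>\<delta> ! (k - 1)\<close>. The \<open>foldr\<close> is the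
  composition of the contractions for \<open>\<delta>\<^sub>k\<^sub>+\<^sub>1, \<dots>, \<delta>\<^sub>n\<^sub>-\<^sub>1\<close>, the last one being applied first. The contraction for
  \<open>\<delta>\<^sub>j\<close> is applied to a word poset of the longest element on \<open>{1..j + 2}\<close>, whence its first
  argument \<open>j + 1\<close>.\<close>

definition ind_seq :: "nat \<Rightarrow> dir list \<Rightarrow> 'a word_poset \<Rightarrow> nat list" where
  "ind_seq n \<delta> P =
    map (\<lambda>k. ind (k + 1) (\<delta> ! (k - 1))
               (foldr (\<lambda>j. contract (j + 1) (\<delta> ! (j - 1))) [k + 1..<n] P)) [1..<n]"

end

theory Submission
  imports Defs
begin

text \<open>A word poset of the longest element is a wiring diagram in which any two wires cross exactly once.
  \<open>D\<close> consists of the crossings on the wire with the largest label and \<open>A\<close> of those on the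
  wire with the smallest one, and a contraction removes that wire. For wires \<open>a < b < c\<close> either
  \<open>ab\<close>, \<open>ac\<close>, \<open>bc\<close> cross in this order or in the reverse order, and these orientations
  determine the poset up to isomorphism. By induction, the orientations of all triples are known except
  for \<open>(p, b, q)\<close> with \<open>p\<close> the smallest and \<open>q\<close> the largest label. The order in which \<open>p\<close>
  crosses the other wires is known as well, so only the place of \<open>q\<close> in that order is open, and
  \<open>ind\<^sub>D\<close> gives it: its unknown part is the number of wires that \<open>p\<close> crosses after \<open>q\<close>.\<close>

section \<open>Wirings\<close>

text \<open>A contraction need not yield the order generated by a word, so the induction does not
  stay among posets of words. It runs over wirings, which remember only a set \<open>W\<close> of
  labels and the times of the crossings. Removing a wire keeps all other labels and all times, so
  nothing has to be renumbered from one level to the next. Both contractions are needed in the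
  inductive step: without the largest wire \<open>q\<close>, the order in which the smallest wire
  \<open>p\<close> meets the others becomes known; without \<open>p\<close>, the side of
  \<open>q\<close> at every crossing that avoids both. Orientations only compare crossings on a
  common wire, whereas the order of a word also relates disjoint crossings in adjacent columns.
  Those are compared through the sum of the labels that run below them.\<close>

definition pairs :: "nat set \<Rightarrow> nat set set" where
  "pairs W = {s. s \<subseteq> W \<and> card s = 2}"

lemma pairsE:
  assumes "s \<in> pairs W"
  obtains a b where "a \<in> W" "b \<in> W" "a < b" "s = {a, b}"
proof -
  from assms obtain a b where ab: "s = {a, b}" "a \<noteq> b" "a \<in> W" "b \<in> W"
    by (auto simp: pairs_def card_2_iff)
  then show ?thesis
    by (cases "a < b") (use that[of a b] that[of b a] in \<open>auto simp: insert_commute\<close>)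
qed

lemma pair_in_pairs [simp]: "{a, b} \<in> pairs W \<longleftrightarrow> a \<in> W \<and> b \<in> W \<and> a \<noteq> b"
  by (auto simp: pairs_def card_2_iff doubleton_eq_iff)

lemma finite_pairs [simp]: "finite W \<Longrightarrow> finite (pairs W)"
  by (simp add: pairs_def)

lemma pairs_minus: "pairs (W - {w}) = {s \<in> pairs W. w \<notin> s}"
  by (auto simp: pairs_def)

lemma Min_pair [simp]: "a < b \<Longrightarrow> Min {a, b} = (a::nat)"
  by simp

text \<open>The crossing of the wires \<open>a\<close> and \<open>b\<close> is the set \<open>{a, b}\<close>, and it happens at time
  \<open>\<tau> {a, b}\<close>. Wires start in the order of their labels from bottom to top, so \<open>under \<tau> t d c\<close> says that
  \<open>d\<close> runs below \<open>c\<close> just before time \<open>t\<close>.\<close>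

definition under :: "(nat set \<Rightarrow> nat) \<Rightarrow> nat \<Rightarrow> nat \<Rightarrow> nat \<Rightarrow> bool" where
  "under \<tau> t d c \<longleftrightarrow> (d < c) \<noteq> (\<tau> {c, d} < t)"

definition below :: "nat set \<Rightarrow> (nat set \<Rightarrow> nat) \<Rightarrow> nat \<Rightarrow> nat \<Rightarrow> nat set" where
  "below W \<tau> t c = {d \<in> W - {c}. under \<tau> t d c}"

definition height :: "nat set \<Rightarrow> (nat set \<Rightarrow> nat) \<Rightarrow> nat \<Rightarrow> nat \<Rightarrow> nat" where
  "height W \<tau> t c = Suc (card (below W \<tau> t c))"

text \<open>Just before two wires cross, the one with the smaller label is still the lower one, so
  its height is the lower of the two swapped positions, that is, the letter of the word.\<close>

definition column :: "nat set \<Rightarrow> (nat set \<Rightarrow> nat) \<Rightarrow> nat set \<Rightarrow> nat" where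
  "column W \<tau> s = height W \<tau> (\<tau> s) (Min s)"

lemma under_flip: "c \<noteq> d \<Longrightarrow> under \<tau> t c d \<longleftrightarrow> \<not> under \<tau> t d c"
  by (auto simp: under_def insert_commute)

text \<open>Orders on the pairs in which \<open>{a, c}\<close> always lies between
  \<open>{a, b}\<close> and \<open>{b, c}\<close> are the reflection orders of type A. The times
  need not be consecutive, so that the same \<open>\<tau>\<close> serves every subset of the
  wires.\<close>

locale wiring =
  fixes W :: "nat set" and \<tau> :: "nat set \<Rightarrow> nat"
  assumes fin: "finite W"
    and inj: "inj_on \<tau> (pairs W)"
    and triple: "\<lbrakk>a \<in> W; b \<in> W; c \<in> W; a < b; b < c\<rbrakk> \<Longrightarrow>
      \<tau> {a, b} < \<tau> {a, c} \<and> \<tau> {a, c} < \<tau> {b, c} \<or> \<tau> {b, c} < \<tau> {a, c} \<and> \<tau> {a, c} < \<tau> {a, b}"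
begin

lemma wiring_minus: "wiring (W - {w}) \<tau>"
  by unfold_locales
    (use fin inj triple in \<open>auto simp: pairs_minus intro: inj_on_subset\<close>)

text \<open>A cycle among labels \<open>a < b < c\<close> would mean that \<open>{a, c}\<close>
  alone has crossed by time \<open>t\<close>, or that it alone has not. Both contradict that it
  crosses between the other two.\<close>

lemma under_trans:
  assumes "x \<in> W" "y \<in> W" "z \<in> W" "x \<noteq> y" "y \<noteq> z" "under \<tau> t x y" "under \<tau> t y z"
  shows "x \<noteq> z" "under \<tau> t x z"
proof -
  show xz: "x \<noteq> z" using assms under_flip by metis
  consider "x < y" "y < z" | "x < z" "z < y" | "y < x" "x < z" | "y < z" "z < x"
    | "z < x" "x < y" | "z < y" "y < x"
    using assms(4,5) xz by linarith
  then show "under \<tau> t x z"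
    by cases (use assms triple[of x y z] triple[of x z y] triple[of y x z] triple[of y z x]
        triple[of z x y] triple[of z y x] in \<open>auto simp: under_def insert_commute\<close>)
qed

section \<open>Heights of wires and columns of crossings\<close>

lemma finite_below [simp]: "finite (below W \<tau> t c)"
  using fin by (simp add: below_def)

lemma height_less:
  assumes "x \<in> W" "y \<in> W" "x \<noteq> y" "under \<tau> t x y"
  shows "height W \<tau> t x < height W \<tau> t y"
proof -
  have "below W \<tau> t x \<subset> below W \<tau> t y"
    using assms under_trans[of _ x y t] by (fastforce simp: below_def)
  then show ?thesis by (simp add: height_def psubset_card_mono)
qed

lemma height_le_card: "x \<in> W \<Longrightarrow> height W \<tau> t x \<le> card W"
  unfolding height_def Suc_le_eq by (rule psubset_card_mono) (use fin in \<open>auto simp: below_def\<close>)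

text \<open>If \<open>c\<close> is outside the interval from \<open>a\<close> to \<open>b\<close>,
  then \<open>{a, b}\<close> comes first or last in the triple, so \<open>c\<close> has crossed both
  wires or neither. If \<open>c\<close> is inside, \<open>{a, b}\<close> is the middle crossing and
  exactly one of the other two has happened. Either way \<open>c\<close> is on the same side of
  both.\<close>

lemma crossing_same_side:
  assumes "a \<in> W" "b \<in> W" "a < b" "c \<in> W" "c \<noteq> a" "c \<noteq> b"
  shows "under \<tau> (\<tau> {a, b}) c a \<longleftrightarrow> under \<tau> (\<tau> {a, b}) c b"
proof -
  consider "c < a" | "a < c" "c < b" | "b < c"
    using assms by linarith
  then show ?thesis
    by cases (use assms triple[of c a b] triple[of a c b] triple[of a b c]
        in \<open>auto simp: under_def insert_commute\<close>)
qed

lemma below_upper: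
  assumes "a \<in> W" "b \<in> W" "a < b"
  shows "below W \<tau> (\<tau> {a, b}) b = insert a (below W \<tau> (\<tau> {a, b}) a)"
proof (rule set_eqI)
  fix x
  have "under \<tau> (\<tau> {a, b}) a b" "\<not> under \<tau> (\<tau> {a, b}) b a"
    using assms by (simp_all add: under_def insert_commute)
  then show "x \<in> below W \<tau> (\<tau> {a, b}) b \<longleftrightarrow> x \<in> insert a (below W \<tau> (\<tau> {a, b}) a)"
    using assms crossing_same_side[OF assms, of x]
    by (cases "x = a"; cases "x = b") (auto simp: below_def)
qed

lemma height_upper:
  assumes "a \<in> W" "b \<in> W" "a < b"
  shows "height W \<tau> (\<tau> {a, b}) b = Suc (height W \<tau> (\<tau> {a, b}) a)"
proof -
  have "a \<notin> below W \<tau> (\<tau> {a, b}) a" by (simp add: below_def)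
  then show ?thesis by (simp add: height_def below_upper[OF assms])
qed

lemma column_bounds:
  assumes "s \<in> pairs W"
  shows "1 \<le> column W \<tau> s" "column W \<tau> s < card W"
proof -
  obtain a b where ab: "a \<in> W" "b \<in> W" "a < b" "s = {a, b}" using assms by (rule pairsE)
  show "1 \<le> column W \<tau> s" by (simp add: column_def height_def)
  show "column W \<tau> s < card W"
    using height_le_card[of b "\<tau> s"] height_upper[of a b] ab by (simp add: column_def)
qed

text \<open>The two crossing wires fill the heights \<open>column W \<tau> s\<close> and its
  successor, and no other wire separates them.\<close>

lemma height_other_wire:
  assumes "s \<in> pairs W" "c \<in> W" "c \<notin> s"
  shows "under \<tau> (\<tau> s) c (Min s) \<Longrightarrow> height W \<tau> (\<tau> s) c < column W \<tau> s"
    and "\<not> under \<tau> (\<tau> s) c (Min s) \<Longrightarrow> column W \<tau> s + 2 \<le> height W \<tau> (\<tau> s) c"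
proof -
  obtain a b where ab: "a \<in> W" "b \<in> W" "a < b" "s = {a, b}" using assms(1) by (rule pairsE)
  show "height W \<tau> (\<tau> s) c < column W \<tau> s" if "under \<tau> (\<tau> s) c (Min s)"
    using that assms ab height_less[of c a "\<tau> s"] by (auto simp: column_def)
  show "column W \<tau> s + 2 \<le> height W \<tau> (\<tau> s) c" if "\<not> under \<tau> (\<tau> s) c (Min s)"
  proof -
    have "\<not> under \<tau> (\<tau> s) c b"
      using that assms ab crossing_same_side[of a b c] by auto
    then have "under \<tau> (\<tau> s) b c" using under_flip[of b c] assms ab by auto
    then show ?thesis
      using height_less[of b c "\<tau> s"] height_upper[of a b] ab assms by (auto simp: column_def)
  qed
qed

subsection \<open>Extreme wires\<close>

fun extreme :: "dir \<Rightarrow> nat \<Rightarrow> bool" where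
  "extreme Asc w \<longleftrightarrow> w \<in> W \<and> (\<forall>c \<in> W. w \<le> c)"
| "extreme Desc w \<longleftrightarrow> w \<in> W \<and> (\<forall>c \<in> W. c \<le> w)"

lemma extreme_mem: "extreme d w \<Longrightarrow> w \<in> W"
  by (cases d) auto

definition idx :: "nat \<Rightarrow> nat \<Rightarrow> nat" where
  "idx w t = card {c \<in> W - {w}. \<tau> {w, c} < t}"

lemma idx_mono: "t \<le> t' \<Longrightarrow> idx w t \<le> idx w t'"
  unfolding idx_def by (rule card_mono) (use fin in auto)

lemma idx_le: "w \<in> W \<Longrightarrow> idx w t \<le> card W - 1"
  unfolding idx_def card_Diff_singleton[symmetric] by (rule card_mono) (use fin in auto)

lemma idx_less:
  assumes "c \<in> W" "c \<noteq> w" "\<tau> {w, c} < t"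
  shows "idx w (\<tau> {w, c}) < idx w t"
  unfolding idx_def by (rule psubset_card_mono) (use fin assms in auto)

text \<open>An extreme wire moves in one direction only: the smallest label starts at the bottom and
  rises at each crossing, the largest starts at the top and falls.\<close>

lemma height_extreme:
  assumes "extreme d w"
  shows "height W \<tau> t w = (case d of Asc \<Rightarrow> Suc (idx w t) | Desc \<Rightarrow> card W - idx w t)"
proof (cases d)
  case Asc
  then have "below W \<tau> t w = {c \<in> W - {w}. \<tau> {w, c} < t}"
    using assms by (auto simp: below_def under_def)
  then show ?thesis by (simp add: Asc height_def idx_def)
next
  case Desc
  then have "below W \<tau> t w = (W - {w}) - {c \<in> W - {w}. \<tau> {w, c} < t}"
    using assms by (force simp: below_def under_def)
  then have "card (below W \<tau> t w) = card W - 1 - idx w t"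
    unfolding idx_def using Desc assms fin
    by (simp add: card_Diff_subset Collect_mono_iff subset_iff)
  moreover have "0 < card W" using assms extreme_mem fin card_gt_0_iff by blast
  moreover have "idx w t \<le> card W - 1" using assms extreme_mem idx_le by blast
  ultimately show ?thesis by (simp add: Desc height_def)
qed

text \<open>The wire moves by one height per crossing, so its crossings run through the columns in
  the order required of the chain. For \<open>Desc\<close> the extreme wire is the upper one at each
  crossing, hence the shift by one against \<open>height_extreme\<close>.\<close>

lemma column_extreme:
  assumes "extreme d w" "c \<in> W" "c \<noteq> w"
  shows "column W \<tau> {w, c} = chain_col (card W - 1) d (Suc (idx w (\<tau> {w, c})))"
proof (cases d)
  case Asc
  then have "Min {w, c} = w" using assms by fastforce
  then show ?thesis using height_extreme[OF assms(1)] Asc by (simp add: column_def)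
next
  case Desc
  then have cw: "c < w" "w \<in> W" using assms by fastforce+
  then have "Min {w, c} = c" by simp
  then show ?thesis
    using height_extreme[OF assms(1), of "\<tau> {w, c}"] Desc height_upper[of c w] cw assms
    by (simp add: column_def insert_commute)
qed

text \<open>The crossing \<open>s\<close> lies on the later side of the extreme wire \<open>w\<close>.\<close>

definition passed :: "dir \<Rightarrow> nat \<Rightarrow> nat set \<Rightarrow> bool" where
  "passed d w s \<longleftrightarrow> (case d of Asc \<Rightarrow> \<not> under \<tau> (\<tau> s) w (Min s) | Desc \<Rightarrow> under \<tau> (\<tau> s) w (Min s))"

text \<open>A crossing off an extreme wire never lies in a column next to that wire, so its column
  stays away from the columns of the two neighbouring crossings on the wire. This makes the chain unique.\<close>

lemma slot:
  assumes "extreme d w" "s \<in> pairs W" "w \<notin> s" "j \<in> {1..card W - 1}"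
    "column W \<tau> s = chain_col (card W - 1) d j"
  shows "passed d w s \<Longrightarrow> j < idx w (\<tau> s)"
    and "\<not> passed d w s \<Longrightarrow> Suc (idx w (\<tau> s)) < j"
  using height_other_wire[OF assms(2) extreme_mem[OF assms(1)] assms(3)]
    height_extreme[OF assms(1), of "\<tau> s"] assms(4,5) idx_le[OF extreme_mem[OF assms(1)], of "\<tau> s"]
  by (cases d; simp add: passed_def; linarith)+

lemma column_minus:
  assumes "s \<in> pairs W" "w \<in> W" "w \<notin> s"
  shows "column (W - {w}) \<tau> s = column W \<tau> s - (if under \<tau> (\<tau> s) w (Min s) then 1 else 0)"
proof -
  have ne: "w \<noteq> Min s"
    using assms(1,3) by (auto elim!: pairsE)
  have B: "below (W - {w}) \<tau> t c = below W \<tau> t c - {w}" for t c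
    by (auto simp: below_def)
  have "w \<in> below W \<tau> (\<tau> s) (Min s) \<longleftrightarrow> under \<tau> (\<tau> s) w (Min s)"
    using ne assms by (auto simp: below_def)
  then show ?thesis
    using card_Suc_Diff1[of "below W \<tau> (\<tau> s) (Min s)" w] by (auto simp: column_def height_def B)
qed

text \<open>The function lists the other wires in the order in which \<open>w\<close> meets them;
  its last property turns comparisons of times into comparisons of ranks.\<close>

lemma idx_enum:
  assumes "w \<in> W"
  obtains f where "bij_betw f {1..card W - 1} (W - {w})"
    "\<And>i. i \<in> {1..card W - 1} \<Longrightarrow> Suc (idx w (\<tau> {w, f i})) = i"
    "\<And>i t. i \<in> {1..card W - 1} \<Longrightarrow> \<tau> {w, f i} < t \<longleftrightarrow> i \<le> idx w t"
proof -
  let ?g = "\<lambda>c. Suc (idx w (\<tau> {w, c}))"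
  have ne: "\<tau> {w, c} \<noteq> \<tau> {w, c'}" if "c \<in> W - {w}" "c' \<in> W - {w}" "c \<noteq> c'" for c c'
    using inj_onD[OF inj, of "{w, c}" "{w, c'}"] that assms by (auto simp: doubleton_eq_iff)
  have inj_g: "inj_on ?g (W - {w})"
  proof (rule inj_onI, rule ccontr)
    fix c c' assume c: "c \<in> W - {w}" "c' \<in> W - {w}" "?g c = ?g c'" "c \<noteq> c'"
    then show False
      using ne[of c c'] idx_less[of c w "\<tau> {w, c'}"] idx_less[of c' w "\<tau> {w, c}"]
      by (auto simp: neq_iff)
  qed
  have "idx w (\<tau> {w, c}) < card W - 1" if "c \<in> W - {w}" for c
    using idx_less[of c w "Suc (\<tau> {w, c})"] idx_le[OF assms, of "Suc (\<tau> {w, c})"] that by auto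
  then have "?g ` (W - {w}) \<subseteq> {1..card W - 1}" by fastforce
  moreover have "card (?g ` (W - {w})) = card W - 1"
    using inj_g by (simp add: card_image assms)
  ultimately have "?g ` (W - {w}) = {1..card W - 1}"
    by (intro card_subset_eq) auto
  then have g: "bij_betw ?g (W - {w}) {1..card W - 1}"
    using inj_g by (simp add: bij_betw_def)
  define f where "f = inv_into (W - {w}) ?g"
  have f: "bij_betw f {1..card W - 1} (W - {w})"
    unfolding f_def by (rule bij_betw_inv_into[OF g])
  have gf: "?g (f i) = i" if "i \<in> {1..card W - 1}" for i
    unfolding f_def using bij_betw_inv_into_right[OF g that] .
  have "\<tau> {w, f i} < t \<longleftrightarrow> i \<le> idx w t" if i: "i \<in> {1..card W - 1}" for i t
  proof -
    have "f i \<in> W - {w}" using f i by (rule bij_betwE[THEN bspec])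
    then show ?thesis
      using idx_less[of "f i" w t] idx_mono[of t "\<tau> {w, f i}" w] gf[OF i]
      by (cases "\<tau> {w, f i} < t") auto
  qed
  then show ?thesis using that[of f] f gf by blast
qed

end

lemma chain_col_inj:
  "\<lbrakk>i \<in> {1..n}; j \<in> {1..n}; chain_col n d i = chain_col n d j\<rbrakk> \<Longrightarrow> i = j"
  by (cases d) auto

lemma chain_col_surj:
  assumes "k \<in> {1..n}"
  obtains j where "j \<in> {1..n}" "chain_col n d j = k"
proof (cases d)
  case Asc
  then show ?thesis using assms that[of k] by simp
next
  case Desc
  have "n + 1 - k \<in> {1..n}" using assms by auto
  then show ?thesis using assms that[of "n + 1 - k"] Desc by simp
qed

section \<open>Word posets of wirings\<close>

text \<open>The order is only prescribed between elements of equal or adjacent columns. The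
  order that a contraction inherits can be finer than the one generated by adjacent columns:
  contracting \<open>D\<close> in the poset of \<open>3 2 3 4 3 2 1 2 3 4\<close> leaves the word \<open>3 2 3 1 2 3\<close>, with its second
  \<open>3\<close> still below the \<open>1\<close>. All chains and indices only depend on the prescribed part.\<close>

locale wiring_poset = wiring W \<tau> for W \<tau> +
  fixes e :: "nat set \<Rightarrow> 'a" and P :: "'a word_poset"
  assumes bij: "bij_betw e (pairs W) (elts P)"
    and trans_leq: "trans (leq P)"
    and col_e: "s \<in> pairs W \<Longrightarrow> col P (e s) = column W \<tau> s"
    and leq_imp: "\<lbrakk>s \<in> pairs W; s' \<in> pairs W; (e s, e s') \<in> leq P\<rbrakk> \<Longrightarrow> \<tau> s \<le> \<tau> s'"
    and leqI: "\<lbrakk>s \<in> pairs W; s' \<in> pairs W; \<tau> s \<le> \<tau> s'; column W \<tau> s \<le> Suc (column W \<tau> s');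
      column W \<tau> s' \<le> Suc (column W \<tau> s)\<rbrakk> \<Longrightarrow> (e s, e s') \<in> leq P"
begin

lemma e_mem: "s \<in> pairs W \<Longrightarrow> e s \<in> elts P"
  using bij by (auto dest: bij_betwE)

lemma e_eq: "\<lbrakk>s \<in> pairs W; s' \<in> pairs W\<rbrakk> \<Longrightarrow> e s = e s' \<longleftrightarrow> s = s'"
  using bij by (auto simp: bij_betw_def inj_on_eq_iff)

lemma less_in_imp: "\<lbrakk>s \<in> pairs W; s' \<in> pairs W; less_in P (e s) (e s')\<rbrakk> \<Longrightarrow> \<tau> s < \<tau> s'"
  using leq_imp[of s s'] inj_onD[OF inj, of s s'] by (auto simp: less_in_def le_less)

lemma less_inI:
  "\<lbrakk>s \<in> pairs W; s' \<in> pairs W; \<tau> s < \<tau> s'; column W \<tau> s \<le> Suc (column W \<tau> s');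
      column W \<tau> s' \<le> Suc (column W \<tau> s)\<rbrakk> \<Longrightarrow> less_in P (e s) (e s')"
  using leqI[of s s'] by (auto simp: less_in_def e_eq)

lemma less_in_same_column:
  "\<lbrakk>s \<in> pairs W; s' \<in> pairs W; column W \<tau> s = column W \<tau> s'\<rbrakk> \<Longrightarrow>
    less_in P (e s) (e s') \<longleftrightarrow> \<tau> s < \<tau> s'"
  using less_in_imp[of s s'] less_inI[of s s'] by (metis le_SucI le_refl)

text \<open>For uniqueness, let \<open>r i\<close> be the number of crossings of \<open>w\<close>
  before the \<open>i\<close>-th member of a rival chain. By \<open>slot\<close>, a member off the
  wire has \<open>i < r i\<close> or \<open>Suc (r i) < i\<close>. Since \<open>r\<close> grows
  along the chain, the second is excluded by induction from the first member on, and the first by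
  induction from the last member down.\<close>

lemma dir_chain_eq:
  assumes ex: "extreme d w" and n: "n = card W - 1"
  shows "dir_chain n d P = e ` {s \<in> pairs W. w \<in> s}"
proof -
  have w: "w \<in> W" using ex by (rule extreme_mem)
  obtain f where f: "bij_betw f {1..n} (W - {w})"
    and idx_f: "\<And>i. i \<in> {1..n} \<Longrightarrow> Suc (idx w (\<tau> {w, f i})) = i"
    and f_less: "\<And>i t. i \<in> {1..n} \<Longrightarrow> \<tau> {w, f i} < t \<longleftrightarrow> i \<le> idx w t"
    using idx_enum[OF w] unfolding n by metis
  define x where "x i = {w, f i}" for i
  have f_mem: "f i \<in> W" "f i \<noteq> w" if "i \<in> {1..n}" for i
    using bij_betw_apply[OF f that] by auto
  have x_mem: "x i \<in> pairs W" if "i \<in> {1..n}" for i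
    using f_mem[OF that] w by (simp add: x_def)
  have col_x: "column W \<tau> (x i) = chain_col n d i" if "i \<in> {1..n}" for i
    using column_extreme[OF ex f_mem[OF that]] idx_f[OF that] by (simp add: x_def n)
  have "x ` {1..n} = {s \<in> pairs W. w \<in> s}"
  proof (intro equalityI subsetI)
    show "s \<in> {s \<in> pairs W. w \<in> s}" if "s \<in> x ` {1..n}" for s
      using that x_mem by (auto simp: x_def)
    fix s assume s: "s \<in> {s \<in> pairs W. w \<in> s}"
    then obtain c where "s = {w, c}" "c \<in> W - {w}"
      by (auto elim!: pairsE)
    then show "s \<in> x ` {1..n}"
      using f by (auto simp: x_def bij_betw_def)
  qed
  then have S0: "e ` {s \<in> pairs W. w \<in> s} = (\<lambda>i. e (x i)) ` {1..n}"
    by (simp add: image_image flip: image_image[of e x])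
  have less_x: "\<tau> (x i) < \<tau> (x j)" if "i < j" "i \<in> {1..n}" "j \<in> {1..n}" for i j
    using f_less[of i "\<tau> (x j)"] idx_f[of j] that by (simp add: x_def)
  \<comment> \<open>\<open>leqI\<close> reaches only adjacent columns, so the chain is linked by
    single steps and transitivity.\<close>
  have step: "chain_col n d i \<le> Suc (chain_col n d (Suc i))"
    "chain_col n d (Suc i) \<le> Suc (chain_col n d i)" for i
    by (cases d; simp)+
  have chain_x: "less_in P (e (x i)) (e (x j))" if "i < j" "i \<in> {1..n}" "j \<in> {1..n}" for i j
    using that
  proof (induction j)
    case (Suc j)
    show ?case
    proof (cases "i = j")
      case True
      then show ?thesis
        using Suc.prems less_x[of i "Suc j"] step[of j]
        by (intro less_inI x_mem) (auto simp: col_x)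
    next
      case False
      then have j: "i < j" "j \<in> {1..n}" using Suc.prems by auto
      then have "less_in P (e (x i)) (e (x j))" using Suc by simp
      moreover have "less_in P (e (x j)) (e (x (Suc j)))"
        using Suc.prems j less_x[of j "Suc j"] step[of j]
        by (intro less_inI x_mem) (auto simp: col_x)
      ultimately have "(e (x i), e (x (Suc j))) \<in> leq P"
        using trans_leq by (auto simp: less_in_def dest: transD)
      moreover have "e (x i) \<noteq> e (x (Suc j))"
        using less_x[OF Suc.prems] x_mem Suc.prems by (auto simp: e_eq)
      ultimately show ?thesis by (simp add: less_in_def)
    qed
  qed simp
  show ?thesis
    unfolding dir_chain_def
  proof (rule the_equality)
    show "\<exists>c. e ` {s \<in> pairs W. w \<in> s} = c ` {1..n} \<and>
        (\<forall>i\<in>{1..n}. c i \<in> elts P \<and> col P (c i) = chain_col n d i) \<and>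
        (\<forall>i\<in>{1..n}. \<forall>j\<in>{1..n}. i < j \<longrightarrow> less_in P (c i) (c j))"
      by (rule exI[of _ "\<lambda>i. e (x i)"]) (simp add: S0 e_mem x_mem col_e col_x chain_x)
    fix S
    assume "\<exists>c. S = c ` {1..n} \<and>
        (\<forall>i\<in>{1..n}. c i \<in> elts P \<and> col P (c i) = chain_col n d i) \<and>
        (\<forall>i\<in>{1..n}. \<forall>j\<in>{1..n}. i < j \<longrightarrow> less_in P (c i) (c j))"
    then obtain c where c: "S = c ` {1..n}"
      "\<And>i. i \<in> {1..n} \<Longrightarrow> c i \<in> elts P \<and> col P (c i) = chain_col n d i"
      "\<And>i j. \<lbrakk>i \<in> {1..n}; j \<in> {1..n}; i < j\<rbrakk> \<Longrightarrow> less_in P (c i) (c j)"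
      by blast
    have "\<exists>s \<in> pairs W. c i = e s" if "i \<in> {1..n}" for i
      using c(2)[OF that] bij by (auto simp: bij_betw_def)
    then obtain s where s: "\<And>i. i \<in> {1..n} \<Longrightarrow> s i \<in> pairs W \<and> c i = e (s i)"
      by metis
    have col_s: "column W \<tau> (s i) = chain_col n d i" if "i \<in> {1..n}" for i
      using c(2)[OF that] s[OF that] by (simp add: col_e)
    have less_s: "\<tau> (s i) < \<tau> (s j)" if "i < j" "i \<in> {1..n}" "j \<in> {1..n}" for i j
      using c(3)[of i j] s[of i] s[of j] that less_in_imp[of "s i" "s j"] by auto
    define r where "r i = idx w (\<tau> (s i))" for i
    have cases: "s i = x i \<and> Suc (r i) = i \<or> i < r i \<or> Suc (r i) < i" if i: "i \<in> {1..n}" for i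
    proof (cases "w \<in> s i")
      case False
      then show ?thesis
        using slot[OF ex, of "s i" i] s[OF i] col_s[OF i] i n unfolding r_def
        by (cases "passed d w (s i)") auto
    next
      case True
      then have "s i \<in> x ` {1..n}" using \<open>x ` {1..n} = _\<close> s[OF i] by blast
      then obtain k where "k \<in> {1..n}" "s i = x k" by blast
      then show ?thesis
        using chain_col_inj[of i n k d] i col_s[OF i] col_x[of k] idx_f[of i] by (auto simp: r_def x_def)
    qed
    have r_mono: "r i \<le> r j" if "i < j" "i \<in> {1..n}" "j \<in> {1..n}" for i j
      using idx_mono[OF less_imp_le[OF less_s[OF that]]] by (simp add: r_def)
    have ge: "i \<le> Suc (r i)" if "i \<in> {1..n}" for i
      using that
    proof (induction i)
      case (Suc i)
      show ?case
      proof (cases "i = 0")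
        case False
        then have i: "i \<in> {1..n}" using Suc.prems by auto
        then consider "s i = x i" "Suc (r i) = i" | "i < r i"
          using cases[OF i] Suc.IH by linarith
        then show ?thesis
        proof cases
          \<comment> \<open>Member \<open>i\<close> is then itself the \<open>i\<close>-th crossing
            on \<open>w\<close>, so \<open>w\<close> has made \<open>i\<close> crossings before
            member \<open>Suc i\<close>.\<close>
          case 1
          then have "i \<le> r (Suc i)"
            using less_s[of i "Suc i"] f_less[OF i, of "\<tau> (s (Suc i))"] i Suc.prems
            by (simp add: x_def r_def)
          then show ?thesis by simp
        next
          case 2
          then show ?thesis using r_mono[of i "Suc i"] i Suc.prems by simp
        qed
      qed simp
    qed simp
    have le: "r i \<le> i" if "i \<in> {1..n}" for i
    proof -
      have "i \<le> n" using that by simp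
      then show ?thesis using that
      proof (induction rule: inc_induct)
        case base
        then show ?case using idx_le[OF w] by (simp add: r_def n)
      next
        case (step k)
        then have k: "k \<in> {1..n}" "Suc k \<in> {1..n}" by auto
        have "Suc (r (Suc k)) = Suc k \<or> Suc (r (Suc k)) < Suc k"
          using cases[OF k(2)] step.IH k by auto
        then show ?case using r_mono[of k "Suc k"] k by auto
      qed
    qed
    have "s i = x i" if "i \<in> {1..n}" for i
      using cases[OF that] ge[OF that] le[OF that] by linarith
    then show "S = e ` {s \<in> pairs W. w \<in> s}"
      using c(1) s by (auto simp: S0)
  qed
qed

section \<open>Indices and contractions along an extreme wire\<close>

context
  fixes d w n
  assumes ex: "extreme d w" and n: "n = card W - 1"
begin

lemma chain_element:
  assumes s: "s \<in> pairs W" "w \<notin> s" and j: "j \<in> {1..n}"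
  obtains u where "u \<in> pairs W" "w \<in> u" "column W \<tau> u = chain_col n d j"
    "\<tau> u < \<tau> s \<longleftrightarrow> j \<le> idx w (\<tau> s)" "\<tau> s < \<tau> u \<longleftrightarrow> idx w (\<tau> s) < j"
proof -
  have w: "w \<in> W" using ex by (rule extreme_mem)
  obtain f where f: "bij_betw f {1..n} (W - {w})"
    and idx_f: "\<And>i. i \<in> {1..n} \<Longrightarrow> Suc (idx w (\<tau> {w, f i})) = i"
    and f_less: "\<And>i t. i \<in> {1..n} \<Longrightarrow> \<tau> {w, f i} < t \<longleftrightarrow> i \<le> idx w t"
    using idx_enum[OF w] unfolding n by metis
  have fj: "f j \<in> W" "f j \<noteq> w" using bij_betw_apply[OF f j] by auto
  have u: "{w, f j} \<in> pairs W" using w fj by simp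
  then have "\<tau> {w, f j} \<noteq> \<tau> s"
    using inj_onD[OF inj, of "{w, f j}" s] s by auto
  then show ?thesis
    using that[of "{w, f j}"] u column_extreme[OF ex fj] idx_f[OF j] f_less[OF j, of "\<tau> s"] n
    by auto
qed

lemma chain_at_column:
  assumes s: "s \<in> pairs W" "w \<notin> s"
  obtains u where "u \<in> pairs W" "w \<in> u" "column W \<tau> u = column W \<tau> s"
    "\<tau> u < \<tau> s \<longleftrightarrow> passed d w s" "\<tau> s < \<tau> u \<longleftrightarrow> \<not> passed d w s"
proof -
  have "column W \<tau> s \<in> {1..n}" using column_bounds[OF s(1)] n by auto
  then obtain j where j: "j \<in> {1..n}" "chain_col n d j = column W \<tau> s" by (rule chain_col_surj)
  obtain u where "u \<in> pairs W" "w \<in> u" "column W \<tau> u = chain_col n d j"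
    "\<tau> u < \<tau> s \<longleftrightarrow> j \<le> idx w (\<tau> s)" "\<tau> s < \<tau> u \<longleftrightarrow> idx w (\<tau> s) < j"
    by (rule chain_element[OF s j(1)])
  then show ?thesis
    using that[of u] slot[OF ex s, of j] j n by (cases "passed d w s") auto
qed

lemma chain_column_unique:
  assumes "u \<in> pairs W" "w \<in> u" "v \<in> pairs W" "w \<in> v" "column W \<tau> u = column W \<tau> v"
  shows "u = v"
proof -
  have w: "w \<in> W" using ex by (rule extreme_mem)
  obtain c c' where c: "u = {w, c}" "v = {w, c'}" "c \<in> W" "c' \<in> W" "c \<noteq> w" "c' \<noteq> w"
    using assms by (auto elim!: pairsE simp: insert_commute)
  have "Suc (idx w (\<tau> {w, b})) \<in> {1..n}" if "b \<in> W" "b \<noteq> w" for b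
    using idx_less[of b w "Suc (\<tau> {w, b})"] idx_le[OF w, of "Suc (\<tau> {w, b})"] that n by auto
  then have "Suc (idx w (\<tau> u)) = Suc (idx w (\<tau> v))"
    using chain_col_inj[of "Suc (idx w (\<tau> u))" n "Suc (idx w (\<tau> v))" d] c assms(5)
      column_extreme[OF ex] n by auto
  then have "\<not> \<tau> u < \<tau> v" "\<not> \<tau> v < \<tau> u"
    using idx_less[of c w "\<tau> v"] idx_less[of c' w "\<tau> u"] c by auto
  then have "\<tau> u = \<tau> v" by simp
  then show ?thesis using inj assms by (auto dest: inj_onD)
qed

lemma above_chain_iff:
  assumes "s \<in> pairs W"
  shows "(\<exists>u \<in> pairs W. w \<in> u \<and> less_in P (e u) (e s) \<and> column W \<tau> u = column W \<tau> s) \<longleftrightarrow>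
    w \<notin> s \<and> passed d w s"
proof (cases "w \<in> s")
  case True
  then have "u = s" if "u \<in> pairs W" "w \<in> u" "column W \<tau> u = column W \<tau> s" for u
    using chain_column_unique[of u s] assms that by blast
  then show ?thesis using True by (auto simp: less_in_def)
next
  case False
  obtain u where u: "u \<in> pairs W" "w \<in> u" "column W \<tau> u = column W \<tau> s"
    "\<tau> u < \<tau> s \<longleftrightarrow> passed d w s" "\<tau> s < \<tau> u \<longleftrightarrow> \<not> passed d w s"
    by (rule chain_at_column[OF assms False])
  have vu: "v = u" if "v \<in> pairs W" "w \<in> v" "column W \<tau> v = column W \<tau> s" for v
    using chain_column_unique[of v u] u that by simp
  have "(\<exists>v \<in> pairs W. w \<in> v \<and> less_in P (e v) (e s) \<and> column W \<tau> v = column W \<tau> s) \<longleftrightarrow>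
      less_in P (e u) (e s)"
    by (metis vu u(1-3))
  also have "\<dots> \<longleftrightarrow> passed d w s"
    using less_in_same_column[OF u(1) assms u(3)] u(4) by blast
  finally show ?thesis using False by blast
qed

lemma below_chain_iff:
  assumes "s \<in> pairs W" "w \<notin> s"
  shows "e s \<in> below_chain n d P \<longleftrightarrow> \<not> passed d w s"
proof -
  obtain u where u: "u \<in> pairs W" "w \<in> u" "column W \<tau> u = column W \<tau> s"
    "\<tau> u < \<tau> s \<longleftrightarrow> passed d w s" "\<tau> s < \<tau> u \<longleftrightarrow> \<not> passed d w s"
    by (rule chain_at_column[OF assms])
  have "e s \<in> below_chain n d P \<longleftrightarrow>
      (\<exists>v \<in> pairs W. w \<in> v \<and> less_in P (e s) (e v) \<and> column W \<tau> s = column W \<tau> v)"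
    using assms by (auto simp: below_chain_def dir_chain_eq[OF ex n] e_mem col_e)
  also have "\<dots> \<longleftrightarrow> less_in P (e s) (e u)"
  proof -
    have vu: "v = u" if "v \<in> pairs W" "w \<in> v" "column W \<tau> s = column W \<tau> v" for v
      using chain_column_unique[of v u] u that by simp
    show ?thesis by (metis vu u(1-3))
  qed
  also have "\<dots> \<longleftrightarrow> \<not> passed d w s"
    using less_in_same_column[OF assms(1) u(1)] u(3,5) by metis
  finally show ?thesis .
qed

text \<open>The chain elements lie in distinct columns, so the summands of \<open>ind\<close> count
  disjoint sets. Their union consists of all crossings on the later side of the wire.\<close>

lemma ind_eq: "ind n d P = card {s \<in> pairs W. w \<notin> s \<and> passed d w s}"
proof -
  let ?S = "\<lambda>u. {k \<in> elts P. less_in P (e u) k \<and> col P k = col P (e u)}"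
  let ?U = "{s \<in> pairs W. w \<in> s}"
  have inj_e: "inj_on e (pairs W)" using bij by (rule bij_betw_imp_inj_on)
  have fin_elts: "finite (elts P)" using bij_betw_finite[OF bij] finite_pairs[OF fin] by blast
  have U: "(\<Union>u \<in> ?U. ?S u) = e ` {s \<in> pairs W. w \<notin> s \<and> passed d w s}"
  proof (intro equalityI subsetI)
    fix k assume "k \<in> (\<Union>u \<in> ?U. ?S u)"
    then obtain u where u: "u \<in> pairs W" "w \<in> u" "k \<in> elts P" "less_in P (e u) k"
      "col P k = col P (e u)" by blast
    from u(3) have "k \<in> e ` pairs W" by (simp only: bij_betw_imp_surj_on[OF bij])
    then obtain s where s: "k = e s" "s \<in> pairs W" by (rule imageE)
    have "column W \<tau> u = column W \<tau> s" using u(5) by (simp add: s col_e u(1))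
    then have "w \<notin> s \<and> passed d w s"
      using above_chain_iff[OF s(2)] u(1,2,4) unfolding s(1) by blast
    then show "k \<in> e ` {s \<in> pairs W. w \<notin> s \<and> passed d w s}"
      using s(2) unfolding s(1) by blast
  next
    fix k assume "k \<in> e ` {s \<in> pairs W. w \<notin> s \<and> passed d w s}"
    then obtain s where s: "k = e s" "s \<in> pairs W" "w \<notin> s" "passed d w s" by blast
    then obtain u where u: "u \<in> pairs W" "w \<in> u" "less_in P (e u) (e s)" "column W \<tau> u = column W \<tau> s"
      using above_chain_iff[OF s(2)] by blast
    then have "k \<in> ?S u" using s by (simp add: e_mem col_e)
    then show "k \<in> (\<Union>u \<in> ?U. ?S u)" using u by blast
  qed
  have "ind n d P = (\<Sum>u \<in> ?U. card (?S u))"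
    unfolding ind_def dir_chain_eq[OF ex n]
    by (subst sum.reindex[OF inj_on_subset[OF inj_e]]) auto
  also have "\<dots> = card (\<Union>u \<in> ?U. ?S u)"
  proof (rule card_UN_disjoint[symmetric])
    show "\<forall>u\<in>?U. \<forall>v\<in>?U. u \<noteq> v \<longrightarrow> ?S u \<inter> ?S v = {}"
    proof (intro ballI impI)
      fix u v assume "u \<in> ?U" "v \<in> ?U" "u \<noteq> v"
      then have "column W \<tau> u \<noteq> column W \<tau> v" using chain_column_unique by blast
      then show "?S u \<inter> ?S v = {}" using \<open>u \<in> ?U\<close> \<open>v \<in> ?U\<close> by (auto simp: col_e)
    qed
    show "finite ?U" using fin by simp
    show "\<forall>u\<in>?U. finite (?S u)" using fin_elts by simp
  qed
  also have "\<dots> = card (e ` {s \<in> pairs W. w \<notin> s \<and> passed d w s})"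
    by (simp only: U)
  also have "\<dots> = card {s \<in> pairs W. w \<notin> s \<and> passed d w s}"
    by (rule card_image[OF inj_on_subset[OF inj_e]]) auto
  finally show ?thesis .
qed

text \<open>Neither the times nor \<open>e\<close> change. The elements of
  \<open>below_chain\<close> are those on the earlier side of \<open>w\<close>; for
  \<open>Asc\<close> they lie above the wire and for \<open>Desc\<close> below it, so in both cases
  \<open>new_col\<close> lowers what is above, as \<open>column_minus\<close> demands.\<close>

lemma wiring_poset_contract: "wiring_poset (W - {w}) \<tau> e (contract n d P)"
proof -
  let ?E = "e ` pairs (W - {w})"
  have w: "w \<in> W" using ex by (rule extreme_mem)
  have E: "elts P - dir_chain n d P = ?E"
  proof -
    have "pairs W - {s \<in> pairs W. w \<in> s} = pairs (W - {w})" by (auto simp: pairs_minus)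
    then show ?thesis
      using inj_on_image_set_diff[of e "pairs W" "pairs W" "{s \<in> pairs W. w \<in> s}"] bij
      by (auto simp: dir_chain_eq[OF ex n] bij_betw_def pairs_minus)
  qed
  have eq: "elts (contract n d P) = ?E" "leq (contract n d P) = leq P \<inter> ?E \<times> ?E"
    "col (contract n d P) = new_col n d P"
    by (simp_all add: contract_def Let_def E)
  have new: "new_col n d P (e s) = column (W - {w}) \<tau> s" if "s \<in> pairs (W - {w})" for s
    using that below_chain_iff[of s]
    by (cases d) (auto simp: pairs_minus column_minus[OF _ w] col_e passed_def)
  interpret W': wiring "W - {w}" \<tau> by (rule wiring_minus)
  \<comment> \<open>Columns that become adjacent only after the contraction are linked by the chain element
    in the column between them.\<close>
  have adjacent: "(e s, e s') \<in> leq P"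
    if s: "s \<in> pairs W" "w \<notin> s" and s': "s' \<in> pairs W" "w \<notin> s'" and le: "\<tau> s \<le> \<tau> s'"
      and c: "column (W - {w}) \<tau> s \<le> Suc (column (W - {w}) \<tau> s')"
        "column (W - {w}) \<tau> s' \<le> Suc (column (W - {w}) \<tau> s)" for s s'
  proof (cases "column W \<tau> s \<le> Suc (column W \<tau> s') \<and> column W \<tau> s' \<le> Suc (column W \<tau> s)")
    case True
    then show ?thesis using leqI s s' le by simp
  next
    case False
    obtain j where j: "j \<in> {1..n}" "chain_col n d j = column W \<tau> s"
    proof (rule chain_col_surj[of "column W \<tau> s" n d])
      show "column W \<tau> s \<in> {1..n}" using column_bounds[OF s(1)] n by simp
    qed
    obtain j' where j': "j' \<in> {1..n}" "chain_col n d j' = column W \<tau> s'"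
    proof (rule chain_col_surj[of "column W \<tau> s'" n d])
      show "column W \<tau> s' \<in> {1..n}" using column_bounds[OF s'(1)] n by simp
    qed
    have mono: "idx w (\<tau> s) \<le> idx w (\<tau> s')" using le by (rule idx_mono)
    \<comment> \<open>A distance of two columns shrinks only if \<open>w\<close> runs between the
      two crossings, which are then on opposite sides of it. By \<open>slot\<close>, the second
      alternative would give \<open>w\<close> more crossings before \<open>s\<close> than before
      \<open>s'\<close>, against \<open>mono\<close>.\<close>
    have "j = j' + 2 \<and> \<not> passed d w s \<and> passed d w s' \<or>
        j' = j + 2 \<and> passed d w s \<and> \<not> passed d w s'"
      using False c column_bounds[OF s(1)] column_bounds[OF s'(1)] j j'
      unfolding column_minus[OF s(1) w s(2)] column_minus[OF s'(1) w s'(2)]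
      by (cases d) (auto simp: passed_def split: if_splits)
    then have jj: "j = j' + 2" "Suc (idx w (\<tau> s)) < j" "j' < idx w (\<tau> s')"
      using slot[OF ex s, of j] slot[OF ex s', of j'] j j' n mono by auto
    then have m: "Suc j' \<in> {1..n}" using j by simp
    obtain u where u: "u \<in> pairs W" "w \<in> u" "column W \<tau> u = chain_col n d (Suc j')"
      "\<tau> s < \<tau> u \<longleftrightarrow> idx w (\<tau> s) < Suc j'"
      using chain_element[OF s m] by metis
    obtain v where v: "v \<in> pairs W" "w \<in> v" "column W \<tau> v = chain_col n d (Suc j')"
      "\<tau> v < \<tau> s' \<longleftrightarrow> Suc j' \<le> idx w (\<tau> s')"
      using chain_element[OF s' m] by metis
    have uv: "v = u" using chain_column_unique[of v u] u v by simp
    have "chain_col n d j = Suc (chain_col n d (Suc j')) \<and> chain_col n d (Suc j') = Suc (chain_col n d j') \<or>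
        chain_col n d (Suc j') = Suc (chain_col n d j) \<and> chain_col n d j' = Suc (chain_col n d (Suc j'))"
      using j(1) jj(1) by (cases d) auto
    then have c3: "column W \<tau> s = Suc (column W \<tau> u) \<and> column W \<tau> u = Suc (column W \<tau> s') \<or>
        column W \<tau> u = Suc (column W \<tau> s) \<and> column W \<tau> s' = Suc (column W \<tau> u)"
      using j(2) j'(2) u(3) by simp
    have "(e s, e u) \<in> leq P"
      using s(1) u(1,4) jj c3 by (intro leqI) auto
    moreover have "(e u, e s') \<in> leq P"
      using s'(1) u(1) v(4) jj c3 unfolding uv by (intro leqI) auto
    ultimately show ?thesis by (rule transD[OF trans_leq])
  qed
  show ?thesis
  proof unfold_locales
    show "bij_betw e (pairs (W - {w})) (elts (contract n d P))"
      using bij by (auto simp: eq bij_betw_def pairs_minus intro: inj_on_subset)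
    show "trans (leq (contract n d P))"
      using trans_leq by (auto simp: eq trans_def)
    show "col (contract n d P) (e s) = column (W - {w}) \<tau> s" if "s \<in> pairs (W - {w})" for s
      using new that by (simp add: eq)
    show "\<tau> s \<le> \<tau> s'" if "s \<in> pairs (W - {w})" "s' \<in> pairs (W - {w})"
      "(e s, e s') \<in> leq (contract n d P)" for s s'
      using that leq_imp by (auto simp: eq pairs_minus)
    show "(e s, e s') \<in> leq (contract n d P)"
      if "s \<in> pairs (W - {w})" "s' \<in> pairs (W - {w})" "\<tau> s \<le> \<tau> s'"
        "column (W - {w}) \<tau> s \<le> Suc (column (W - {w}) \<tau> s')"
        "column (W - {w}) \<tau> s' \<le> Suc (column (W - {w}) \<tau> s)" for s s'
      using that adjacent[of s s'] by (simp add: eq pairs_minus)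
  qed
qed

end

end

section \<open>The indices determine the orientation\<close>

text \<open>The last letter governs the first contraction, and its index is taken on
  \<open>P\<close> itself; hence the induction strips \<open>\<delta>\<close> from the
  right.\<close>

lemma ind_seq_snoc:
  assumes "1 \<le> m" "length \<delta> = m - 1"
  shows "ind_seq (Suc m) (\<delta> @ [d]) P = ind_seq m \<delta> (contract (Suc m) d P) @ [ind (Suc m) d P]"
proof -
  have "foldr (\<lambda>j. contract (j + 1) ((\<delta> @ [d]) ! (j - 1))) [k + 1..<Suc m] P =
      foldr (\<lambda>j. contract (j + 1) (\<delta> ! (j - 1))) [k + 1..<m] (contract (Suc m) d P)"
    if k: "k \<in> set [1..<m]" for k
  proof -
    have "[k + 1..<Suc m] = [k + 1..<m] @ [m]" using k by simp
    moreover have "foldr (\<lambda>j. contract (j + 1) ((\<delta> @ [d]) ! (j - 1))) [k + 1..<m] R =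
        foldr (\<lambda>j. contract (j + 1) (\<delta> ! (j - 1))) [k + 1..<m] R" for R :: "'a word_poset"
      using assms by (intro foldr_cong) (auto simp: nth_append)
    ultimately show ?thesis using assms by (simp add: nth_append)
  qed
  then show ?thesis
    using assms by (auto simp: ind_seq_def nth_append)
qed

text \<open>By \<open>triple\<close>, comparing \<open>{a, b}\<close> with \<open>{b, c}\<close>
  also settles the place of \<open>{a, c}\<close>, so one bit per triple suffices.\<close>

definition same_orientation :: "nat set \<Rightarrow> (nat set \<Rightarrow> nat) \<Rightarrow> (nat set \<Rightarrow> nat) \<Rightarrow> bool" where
  "same_orientation W \<tau> \<tau>' \<longleftrightarrow> (\<forall>a \<in> W. \<forall>b \<in> W. \<forall>c \<in> W. a < b \<longrightarrow> b < c \<longrightarrow>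
    (\<tau> {a, b} < \<tau> {b, c} \<longleftrightarrow> \<tau>' {a, b} < \<tau>' {b, c}))"

text \<open>Two different crossings on a common wire lie in a single triple, whose whole order is
  fixed by its orientation.\<close>

lemma same_orientation_common_wire:
  assumes "wiring W \<tau>" "wiring W \<tau>'" "same_orientation W \<tau> \<tau>'"
    and mem: "x \<in> W" "y \<in> W" "z \<in> W" and ne: "x \<noteq> y" "x \<noteq> z"
  shows "\<tau> {x, y} < \<tau> {x, z} \<longleftrightarrow> \<tau>' {x, y} < \<tau>' {x, z}"
proof (cases "y = z")
  case False
  interpret A: wiring W \<tau> by fact
  interpret B: wiring W \<tau>' by fact
  have order: "\<tau> {a, b} < \<tau> {a, c} \<and> \<tau> {a, c} < \<tau> {b, c} \<and>
      \<tau>' {a, b} < \<tau>' {a, c} \<and> \<tau>' {a, c} < \<tau>' {b, c} \<or>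
      \<tau> {b, c} < \<tau> {a, c} \<and> \<tau> {a, c} < \<tau> {a, b} \<and>
      \<tau>' {b, c} < \<tau>' {a, c} \<and> \<tau>' {a, c} < \<tau>' {a, b}"
    if "a \<in> W" "b \<in> W" "c \<in> W" "a < b" "b < c" for a b c
  proof -
    have "\<tau> {a, b} < \<tau> {b, c} \<longleftrightarrow> \<tau>' {a, b} < \<tau>' {b, c}"
      using assms(3) that by (simp add: same_orientation_def)
    then show ?thesis
      using A.triple[OF that] B.triple[OF that] by (meson less_trans less_asym)
  qed
  have sym: "{y, x} = {x, y}" "{z, x} = {x, z}" "{z, y} = {y, z}" by auto
  consider "x < y" "y < z" | "x < z" "z < y" | "y < x" "x < z" | "y < z" "z < x"
    | "z < x" "x < y" | "z < y" "y < x"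
    using ne False by linarith
  then show ?thesis
  proof cases
    case 1
    then show ?thesis using order[OF mem] by linarith
  next
    case 2
    then show ?thesis using order[OF mem(1,3,2)] unfolding sym by linarith
  next
    case 3
    then show ?thesis using order[OF mem(2,1,3)] unfolding sym by linarith
  next
    case 4
    then show ?thesis using order[OF mem(2,3,1)] unfolding sym by linarith
  next
    case 5
    then show ?thesis using order[OF mem(3,1,2)] unfolding sym by linarith
  next
    case 6
    then show ?thesis using order[OF mem(3,2,1)] unfolding sym by linarith
  qed
qed simp

lemma same_orientation_extend:
  assumes \<tau>: "wiring W \<tau>" and \<tau>': "wiring W \<tau>'"
    and p: "p \<in> W" "\<And>c. c \<in> W \<Longrightarrow> p \<le> c" and q: "q \<in> W" "\<And>c. c \<in> W \<Longrightarrow> c \<le> q" and pq: "p \<noteq> q"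
    and same_q: "same_orientation (W - {q}) \<tau> \<tau>'" and same_p: "same_orientation (W - {p}) \<tau> \<tau>'"
    and card: "card {s \<in> pairs W. q \<notin> s \<and> under \<tau> (\<tau> s) q (Min s)} =
      card {s \<in> pairs W. q \<notin> s \<and> under \<tau>' (\<tau>' s) q (Min s)}"
  shows "same_orientation W \<tau> \<tau>'"
proof -
  interpret A: wiring W \<tau> by fact
  interpret B: wiring W \<tau>' by fact
  note common_q = same_orientation_common_wire[OF A.wiring_minus B.wiring_minus same_q]
  note common_p = same_orientation_common_wire[OF A.wiring_minus B.wiring_minus same_p]
  \<comment> \<open>\<open>Y\<close> is the part of the index that is known already, as its triples
    avoid \<open>p\<close>. \<open>X\<close> gives the rest: when \<open>p\<close> crosses
    \<open>b\<close>, the wire \<open>q\<close> runs below them just if it has crossed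
    \<open>p\<close> before.\<close>
  define X where "X t = {b \<in> W - {p, q}. t {p, q} < t {p, b}}" for t :: "nat set \<Rightarrow> nat"
  define Y where "Y t = {s \<in> pairs (W - {p, q}). under t (t s) q (Min s)}" for t :: "nat set \<Rightarrow> nat"
  have split: "{s \<in> pairs W. q \<notin> s \<and> under t (t s) q (Min s)} = Y t \<union> (\<lambda>b. {p, b}) ` X t" for t
  proof (intro equalityI subsetI)
    fix s assume s: "s \<in> {s \<in> pairs W. q \<notin> s \<and> under t (t s) q (Min s)}"
    then have "s \<in> pairs W" by simp
    then obtain a b where ab: "a \<in> W" "b \<in> W" "a < b" "s = {a, b}" by (rule pairsE)
    have "p \<noteq> b" using p(2)[OF ab(1)] ab(3) by simp
    moreover have "\<not> q < a" using q(2)[OF ab(1)] by simp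
    ultimately show "s \<in> Y t \<union> (\<lambda>b. {p, b}) ` X t"
      using s ab by (cases "a = p") (auto simp: X_def Y_def under_def)
  next
    fix s assume "s \<in> Y t \<union> (\<lambda>b. {p, b}) ` X t"
    then consider "s \<in> Y t" | b where "b \<in> X t" "s = {p, b}" by blast
    then show "s \<in> {s \<in> pairs W. q \<notin> s \<and> under t (t s) q (Min s)}"
    proof cases
      case 1
      then show ?thesis by (auto simp: Y_def pairs_def)
    next
      case 2
      then have b: "b \<in> W" "b \<noteq> p" "b \<noteq> q" "t {p, q} < t {p, b}" by (auto simp: X_def)
      then have "p < b" using p(2)[of b] by simp
      moreover have "\<not> q < p" using q(2)[OF p(1)] by simp
      ultimately show ?thesis using b p(1) pq 2(2) by (auto simp: under_def)
    qed
  qed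
  have fX: "finite (X t)" and fY: "finite (Y t)" for t using A.fin by (auto simp: X_def Y_def)
  have cardXY: "card (Y t \<union> (\<lambda>b. {p, b}) ` X t) = card (Y t) + card (X t)" for t
  proof -
    have "inj_on (\<lambda>b. {p, b}) (X t)" by (auto simp: inj_on_def doubleton_eq_iff)
    moreover have "Y t \<inter> (\<lambda>b. {p, b}) ` X t = {}" by (auto simp: Y_def pairs_def)
    ultimately show ?thesis using fX fY by (simp add: card_Un_disjoint card_image)
  qed
  have "Y \<tau> = Y \<tau>'"
  proof -
    have "under \<tau> (\<tau> s) q (Min s) \<longleftrightarrow> under \<tau>' (\<tau>' s) q (Min s)" if "s \<in> pairs (W - {p, q})" for s
    proof -
      obtain a b where "a \<in> W - {p, q}" "b \<in> W - {p, q}" "a < b" "s = {a, b}"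
        using \<open>s \<in> _\<close> by (rule pairsE)
      then show ?thesis using common_p[of a q b] q(1) pq by (auto simp: under_def)
    qed
    then show ?thesis by (auto simp: Y_def)
  qed
  then have "card (X \<tau>) = card (X \<tau>')" using card unfolding split cardXY by simp
  \<comment> \<open>Both sets are final segments of the order in which \<open>p\<close> meets the
    wires other than \<open>q\<close>, and by \<open>same_q\<close> this order is the same for
    \<open>\<tau>\<close> and \<open>\<tau>'\<close>. Nested sets of equal size coincide.\<close>
  moreover have "X \<tau> \<subseteq> X \<tau>' \<or> X \<tau>' \<subseteq> X \<tau>"
  proof (rule ccontr)
    assume "\<not> ?thesis"
    then obtain i j where ij: "i \<in> X \<tau>" "i \<notin> X \<tau>'" "j \<in> X \<tau>'" "j \<notin> X \<tau>" by blast
    then have "\<tau> {p, j} < \<tau> {p, i}" "\<tau>' {p, i} < \<tau>' {p, j}" "i \<in> W - {p, q}" "j \<in> W - {p, q}"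
      by (auto simp: X_def)
    then show False using common_q[of p j i] p(1) pq by auto
  qed
  ultimately have X: "X \<tau> = X \<tau>'" using fX card_subset_eq by metis
  show ?thesis
    unfolding same_orientation_def
  proof (intro ballI impI)
    fix a b c assume abc: "a \<in> W" "b \<in> W" "c \<in> W" "a < b" "b < c"
    have le: "p \<le> a" "c \<le> q" using p(2) q(2) abc by auto
    consider "c \<noteq> q" | "a \<noteq> p" | "a = p" "c = q" by blast
    then show "\<tau> {a, b} < \<tau> {b, c} \<longleftrightarrow> \<tau>' {a, b} < \<tau>' {b, c}"
    proof cases
      case 1
      then show ?thesis using same_q abc le by (simp add: same_orientation_def)
    next
      case 2
      then show ?thesis using same_p abc le by (simp add: same_orientation_def)
    next
      case 3
      have "b \<in> X \<tau> \<longleftrightarrow> b \<in> X \<tau>'" using X by simp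
      then have "\<tau> {a, c} < \<tau> {a, b} \<longleftrightarrow> \<tau>' {a, c} < \<tau>' {a, b}"
        using abc 3 by (simp add: X_def)
      then show ?thesis
        using A.triple[OF abc] B.triple[OF abc] by linarith
    qed
  qed
qed

text \<open>Once the last letter is fixed, the earlier ones still range over all sequences, so the
  hypothesis passes to the contractions in both directions.\<close>

lemma same_orientation_if_ind_seq_eq:
  fixes P :: "'a word_poset" and Q :: "'b word_poset"
  assumes "wiring_poset W \<tau> e P" "wiring_poset W \<tau>' e' Q" "card W = Suc n" "1 \<le> n"
    and "\<And>\<delta>. length \<delta> = n - 1 \<Longrightarrow> ind_seq n \<delta> P = ind_seq n \<delta> Q"
  shows "same_orientation W \<tau> \<tau>'"
  using assms
proof (induction n arbitrary: W P Q)
  case (Suc m)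
  interpret A: wiring_poset W \<tau> e P by fact
  interpret B: wiring_poset W \<tau>' e' Q by fact
  show ?case
  proof (cases "m = 0")
    case True
    have False if "a \<in> W" "b \<in> W" "c \<in> W" "a < b" "b < c" for a b c
      using card_mono[OF A.fin, of "{a, b, c}"] that Suc.prems(3) True by simp
    then show ?thesis by (auto simp: same_orientation_def)
  next
    case False
    then have m: "1 \<le> m" by simp
    have W: "W \<noteq> {}" "Suc m = card W - 1" using Suc.prems(3) by auto
    have seq: "ind_seq m \<delta> (contract (Suc m) d P) = ind_seq m \<delta> (contract (Suc m) d Q) \<and>
        ind (Suc m) d P = ind (Suc m) d Q" if "length \<delta> = m - 1" for \<delta> d
    proof -
      have "length (\<delta> @ [d]) = Suc m - 1" using that m by simp
      then show ?thesis
        using Suc.prems(5)[of "\<delta> @ [d]"] unfolding ind_seq_snoc[OF m that] by simp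
    qed
    have same: "same_orientation (W - {w}) \<tau> \<tau>'" if "A.extreme d w" for d w
    proof (rule Suc.IH[OF A.wiring_poset_contract B.wiring_poset_contract])
      show "card (W - {w}) = Suc m" using A.extreme_mem[OF that] Suc.prems(3) by simp
      show "B.extreme d w" using that by (cases d) auto
    qed (use that W m seq in auto)
    define p where "p = Min W"
    define q where "q = Max W"
    have p: "p \<in> W" "\<And>c. c \<in> W \<Longrightarrow> p \<le> c" and q: "q \<in> W" "\<And>c. c \<in> W \<Longrightarrow> c \<le> q"
      using A.fin W(1) by (auto simp: p_def q_def)
    have pq: "p \<noteq> q"
    proof
      assume "p = q"
      then have "W \<subseteq> {p}" using p q by (metis eq_iff singletonI subsetI)
      then show False using card_mono[of "{p}" W] Suc.prems(3) m by simp
    qed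
    have ex: "A.extreme Asc p" "A.extreme Desc q" "B.extreme Desc q" using p q by auto
    \<comment> \<open>The index for the last letter does not depend on the letters before it, so any
      list of the right length serves.\<close>
    have "ind (Suc m) Desc P = ind (Suc m) Desc Q"
      using seq[of "replicate (m - 1) Asc"] by simp
    then have card: "card {s \<in> pairs W. q \<notin> s \<and> under \<tau> (\<tau> s) q (Min s)} =
        card {s \<in> pairs W. q \<notin> s \<and> under \<tau>' (\<tau>' s) q (Min s)}"
      using A.ind_eq[OF ex(2) W(2)] B.ind_eq[OF ex(3) W(2)]
      by (simp add: A.passed_def B.passed_def)
    show ?thesis
      by (rule same_orientation_extend[OF A.wiring_axioms B.wiring_axioms p q pq same[OF ex(2)]
            same[OF ex(1)] card])
  qed
qed simp


section \<open>Wirings of longest words\<close>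

text \<open>The inversion set recorded by values: \<open>inv v\<close> is the position of a label,
  and a pair counts when the larger label comes first.\<close>

definition crossed :: "nat \<Rightarrow> (nat \<Rightarrow> nat) \<Rightarrow> nat set set" where
  "crossed m v = {s \<in> pairs {1..m}. inv v (Max s) < inv v (Min s)}"

lemma Max_pair [simp]: "a < b \<Longrightarrow> Max {a, b} = (b::nat)"
  by simp

lemma pair_in_crossed:
  "a < b \<Longrightarrow> {a, b} \<in> crossed m v \<longleftrightarrow> a \<in> {1..m} \<and> b \<in> {1..m} \<and> inv v b < inv v a"
  by (auto simp: crossed_def)

lemma crossed_subset: "crossed m v \<subseteq> pairs {1..m}"
  by (auto simp: crossed_def)

lemma crossed_id: "crossed m id = {}"
  by (auto simp: crossed_def elim!: pairsE)

lemma finite_crossed [simp]: "finite (crossed m v)"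
  by (rule finite_subset[OF crossed_subset]) simp

lemma transpose_Suc_less_iff:
  fixes x y i :: nat
  assumes "x \<noteq> y"
  shows "Transposition.transpose i (Suc i) y < Transposition.transpose i (Suc i) x \<longleftrightarrow>
    (y < x) \<noteq> ({x, y} = {i, Suc i})"
  using assms by (auto simp: Transposition.transpose_def doubleton_eq_iff)

text \<open>Appending a letter swaps the labels at the adjacent positions \<open>i\<close> and
  \<open>Suc i\<close>; no other pair changes its relative order.\<close>

lemma crossed_transpose:
  assumes v: "v permutes {1..m}" and s: "s \<in> pairs {1..m}"
  shows "s \<in> crossed m (v \<circ> Transposition.transpose i (Suc i)) \<longleftrightarrow>
    (s \<in> crossed m v) \<noteq> (s = {v i, v (Suc i)})"
proof -
  obtain a b where ab: "a \<in> {1..m}" "b \<in> {1..m}" "a < b" "s = {a, b}" using s by (rule pairsE)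
  have "inv (v \<circ> Transposition.transpose i (Suc i)) = Transposition.transpose i (Suc i) \<circ> inv v"
    by (subst o_inv_distrib) (use permutes_bij[OF v] in auto)
  moreover have "inv v a \<noteq> inv v b"
    using ab(3) by (simp add: permutes_inv_eq[OF v] permutes_inverses[OF v])
  moreover have "{inv v a, inv v b} = {i, Suc i} \<longleftrightarrow> s = {v i, v (Suc i)}"
    unfolding ab(4) by (auto simp: doubleton_eq_iff permutes_inv_eq[OF v])
  ultimately show ?thesis
    using ab transpose_Suc_less_iff[of "inv v a" "inv v b" i] by (simp add: pair_in_crossed)
qed

lemma word_perm_Nil [simp]: "word_perm [] = id"
  by (simp add: word_perm_def)

lemma word_perm_snoc: "word_perm (xs @ [i]) = word_perm xs \<circ> Transposition.transpose i (Suc i)"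
  by (induction xs) (simp_all add: word_perm_def comp_assoc)

lemma word_perm_permutes: "set is \<subseteq> {1..<m} \<Longrightarrow> word_perm is permutes {1..m}"
proof (induction "is" rule: rev_induct)
  case (snoc i xs)
  have xs: "set xs \<subseteq> {1..<m}" and i: "i \<in> {1..m}" "Suc i \<in> {1..m}" using snoc.prems by auto
  show ?case
    unfolding word_perm_snoc by (rule permutes_compose[OF permutes_swap_id[OF i] snoc.IH[OF xs]])
qed (simp only: word_perm_Nil permutes_id)

lemma card_crossed_transpose_le:
  assumes "v permutes {1..m}"
  shows "card (crossed m (v \<circ> Transposition.transpose i (Suc i))) \<le> Suc (card (crossed m v))"
proof -
  have "crossed m (v \<circ> Transposition.transpose i (Suc i)) \<subseteq> insert {v i, v (Suc i)} (crossed m v)"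
    using crossed_transpose[OF assms] crossed_subset by blast
  then have "card (crossed m (v \<circ> Transposition.transpose i (Suc i))) \<le>
      card (insert {v i, v (Suc i)} (crossed m v))"
    by (intro card_mono) simp_all
  also have "\<dots> \<le> Suc (card (crossed m v))" by (simp add: card_insert_if)
  finally show ?thesis .
qed

lemma card_crossed_le_length:
  "set is \<subseteq> {1..<m} \<Longrightarrow> card (crossed m (word_perm is)) \<le> length is"
proof (induction "is" rule: rev_induct)
  case Nil
  show ?case by (simp only: word_perm_Nil crossed_id card.empty)
next
  case (snoc i xs)
  have xs: "set xs \<subseteq> {1..<m}" using snoc.prems by simp
  have "card (crossed m (word_perm (xs @ [i]))) \<le> Suc (card (crossed m (word_perm xs)))"
    unfolding word_perm_snoc by (rule card_crossed_transpose_le[OF word_perm_permutes[OF xs]])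
  also have "\<dots> \<le> Suc (length xs)" using snoc.IH[OF xs] by simp
  finally show ?case by (simp only: length_append_singleton)
qed

lemma ascending_permutes_id:
  fixes v :: "nat \<Rightarrow> nat"
  assumes v: "v permutes {1..m}" and asc: "\<And>i. i \<in> {1..<m} \<Longrightarrow> v i < v (Suc i)"
  shows "v = id"
proof
  fix x
  have mem: "v i \<in> {1..m}" if "i \<in> {1..m}" for i
    using permutes_in_image[OF v] that by simp
  show "v x = id x"
  proof (cases "x \<in> {1..m}")
    case True
    have "x \<le> v x" using True
    proof (induction x)
      case (Suc i)
      then show ?case using asc[of i] mem[of "Suc i"] by (cases "i = 0") auto
    qed simp
    moreover have "x \<le> m" using True by simp
    then have "v x \<le> x" using True
    proof (induction rule: inc_induct)
      case base
      then show ?case using mem[of m] by simp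
    next
      case (step k)
      then show ?case using asc[of k] by auto
    qed
    ultimately show ?thesis by simp
  qed (use permutes_not_in[OF v] in auto)
qed

text \<open>Bubble sort: a swap at a descent removes exactly one inversion, and being its own
  inverse it becomes the last letter of the word.\<close>

lemma word_of_permutation:
  assumes "v permutes {1..m}"
  shows "\<exists>is \<in> words m v. length is = card (crossed m v)"
  using assms
proof (induction "card (crossed m v)" arbitrary: v rule: less_induct)
  case less
  note v = \<open>v permutes {1..m}\<close>
  show ?case
  proof (cases "\<forall>i \<in> {1..<m}. v i < v (Suc i)")
    case True
    then have "v = id" using ascending_permutes_id[OF v] by blast
    then have "[] \<in> words m v" by (simp add: words_def)
    then show ?thesis by (intro bexI[of _ "[]"]) (simp_all only: \<open>v = id\<close> crossed_id list.size card.empty)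
  next
    case False
    then obtain i where i: "i \<in> {1..<m}" "\<not> v i < v (Suc i)" by blast
    define u where "u = v \<circ> Transposition.transpose i (Suc i)"
    have "v i \<noteq> v (Suc i)" using permutes_inj[OF v] by (simp add: inj_eq)
    then have desc: "v (Suc i) < v i" using i by simp
    have u: "u permutes {1..m}"
      unfolding u_def using i by (intro permutes_compose[OF permutes_swap_id v]) auto
    have "{v (Suc i), v i} \<in> crossed m v"
      unfolding pair_in_crossed[OF desc] permutes_in_image[OF v] permutes_inverses[OF v]
      using i(1) by simp
    then have vi: "{v i, v (Suc i)} \<in> crossed m v" by (simp only: insert_commute)
    have "crossed m u = crossed m v - {{v i, v (Suc i)}}"
    proof (rule set_eqI)
      fix s
      show "s \<in> crossed m u \<longleftrightarrow> s \<in> crossed m v - {{v i, v (Suc i)}}"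
        using crossed_transpose[OF v, of s i] crossed_subset[of m u] crossed_subset[of m v] vi
        unfolding u_def by (cases "s \<in> pairs {1..m}") auto
    qed
    then have card: "Suc (card (crossed m u)) = card (crossed m v)"
      using vi by (simp only: card_Suc_Diff1 finite_crossed)
    then have "card (crossed m u) < card (crossed m v)" by linarith
    then obtain us where us: "us \<in> words m u" "length us = card (crossed m u)"
      using less.hyps[OF _ u] by blast
    have "u \<circ> Transposition.transpose i (Suc i) = v"
      by (simp add: u_def comp_assoc)
    then have "word_perm (us @ [i]) = v" using us(1) by (simp only: words_def word_perm_snoc mem_Collect_eq)
    moreover have "set (us @ [i]) \<subseteq> {1..<m}" using us(1) i(1) by (simp add: words_def)
    ultimately have "us @ [i] \<in> words m v" by (simp only: words_def mem_Collect_eq)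
    then show ?thesis using us(2) card by (intro bexI[of _ "us @ [i]"]) simp_all
  qed
qed

lemma perm_length_eq: "v permutes {1..m} \<Longrightarrow> perm_length m v = card (crossed m v)"
  unfolding perm_length_def
  by (rule Least_equality)
    (use word_of_permutation card_crossed_le_length in \<open>auto simp: words_def\<close>)

section \<open>The longest permutation\<close>

definition reversal :: "nat \<Rightarrow> nat \<Rightarrow> nat" where
  "reversal m i = (if i \<in> {1..m} then m + 1 - i else i)"

lemma reversal_involution: "reversal m \<circ> reversal m = id"
  by (rule ext) (auto simp: reversal_def)

lemma reversal_permutes: "reversal m permutes {1..m}"
proof (rule bij_imp_permutes)
  show "bij_betw (reversal m) {1..m} {1..m}"
    by (rule bij_betw_byWitness[where f' = "reversal m"]) (auto simp: reversal_def)
qed (auto simp: reversal_def)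

lemma crossed_reversal: "crossed m (reversal m) = pairs {1..m}"
proof -
  have "inv (reversal m) = reversal m"
    by (rule inv_unique_comp[OF reversal_involution reversal_involution])
  then show ?thesis by (auto simp: crossed_def reversal_def elim!: pairsE)
qed

text \<open>If all pairs are inverted, \<open>v\<close> is decreasing, so its composition with
  \<open>reversal m\<close> is ascending and hence the identity.\<close>

lemma fully_crossed_imp_reversal:
  assumes v: "v permutes {1..m}" and full: "crossed m v = pairs {1..m}"
  shows "v = reversal m"
proof -
  have "v (reversal m i) < v (reversal m (Suc i))" if i: "i \<in> {1..<m}" for i
  proof (rule ccontr)
    let ?j = "m - i"
    have j: "reversal m i = Suc ?j" "reversal m (Suc i) = ?j" "?j \<in> {1..m}" "Suc ?j \<in> {1..m}"
      using i by (auto simp: reversal_def)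
    assume "\<not> ?thesis"
    moreover have "v ?j \<noteq> v (Suc ?j)" using permutes_inj[OF v] by (simp add: inj_eq)
    ultimately have less: "v ?j < v (Suc ?j)" unfolding j by simp
    have "{v ?j, v (Suc ?j)} \<in> crossed m v"
      unfolding full pair_in_pairs permutes_in_image[OF v] using less j(3,4)
      by (intro conjI) (assumption | simp)+
    then show False
      unfolding pair_in_crossed[OF less] by (simp add: permutes_inverses[OF v])
  qed
  then have "v \<circ> reversal m = id"
    by (intro ascending_permutes_id[OF permutes_compose[OF reversal_permutes v]]) simp
  then have "v \<circ> (reversal m \<circ> reversal m) = reversal m" by (metis comp_assoc id_comp)
  then show ?thesis by (simp only: reversal_involution comp_id)
qed

lemma longest_perm_eq: "longest_perm m = reversal m"
  unfolding longest_perm_def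
proof (rule the_equality)
  have le: "card (crossed m v) \<le> card (pairs {1..m})" for v
    by (rule card_mono[OF _ crossed_subset]) simp
  show "reversal m permutes {1..m} \<and>
      (\<forall>v. v permutes {1..m} \<longrightarrow> perm_length m v \<le> perm_length m (reversal m))"
    using le by (metis perm_length_eq reversal_permutes crossed_reversal)
  fix w assume w: "w permutes {1..m} \<and> (\<forall>v. v permutes {1..m} \<longrightarrow> perm_length m v \<le> perm_length m w)"
  then have "perm_length m (reversal m) \<le> perm_length m w" using reversal_permutes by blast
  then have "card (pairs {1..m}) \<le> card (crossed m w)"
    using w by (simp only: perm_length_eq reversal_permutes crossed_reversal)
  then have "crossed m w = pairs {1..m}"
    by (intro card_seteq crossed_subset) simp_all
  then show "w = reversal m" using fully_crossed_imp_reversal w by blast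
qed


locale longest_word =
  fixes m :: nat and ws :: "nat list"
  assumes letters: "set ws \<subseteq> {1..<m}"
    and full: "crossed m (word_perm ws) = pairs {1..m}"
    and len: "length ws = card (pairs {1..m})"

lemma longest_word_if_reduced:
  assumes "ws \<in> reduced_words m (longest_perm m)"
  shows "longest_word m ws"
proof
  have ws: "set ws \<subseteq> {1..<m}" "word_perm ws = reversal m" "length ws = perm_length m (reversal m)"
    using assms unfolding reduced_words_def words_def longest_perm_eq by auto
  show "set ws \<subseteq> {1..<m}" by (rule ws)
  show "crossed m (word_perm ws) = pairs {1..m}" unfolding ws(2) by (rule crossed_reversal)
  show "length ws = card (pairs {1..m})"
    unfolding ws(3) perm_length_eq[OF reversal_permutes] crossed_reversal ..
qed

section \<open>Arrangements of the wires along a longest word\<close>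

context longest_word
begin

text \<open>The label of the wire at height \<open>h\<close> after \<open>t\<close> letters is \<open>arr t h\<close>. Letters are numbered from 0 here, but
  times from 1, in agreement with the elements of the poset of a word.\<close>

definition arr :: "nat \<Rightarrow> nat \<Rightarrow> nat" where
  "arr t = word_perm (take t ws)"

definition crossing :: "nat \<Rightarrow> nat set" where
  "crossing t = {arr t (ws ! t), arr t (Suc (ws ! t))}"

definition time :: "nat set \<Rightarrow> nat" where
  "time s = Suc (inv_into {..<length ws} crossing s)"

lemma letter: "t < length ws \<Longrightarrow> 1 \<le> ws ! t \<and> ws ! t < m"
  using subsetD[OF letters nth_mem] by simp

lemma arr_permutes: "arr t permutes {1..m}"
  unfolding arr_def
  by (rule word_perm_permutes) (use letters set_take_subset[of t ws] in blast)

lemma arr_Suc: "t < length ws \<Longrightarrow> arr (Suc t) = arr t \<circ> Transposition.transpose (ws ! t) (Suc (ws ! t))"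
  unfolding arr_def by (simp only: take_Suc_conv_app_nth word_perm_snoc)

text \<open>A letter adds at most one inversion, and there are only as many letters as inversions at
  the end, so each of them has to add one.\<close>

lemma card_crossed_arr:
  assumes "t \<le> length ws"
  shows "card (crossed m (arr t)) = t"
proof (rule antisym)
  have "card (crossed m (arr t)) \<le> length (take t ws)"
    unfolding arr_def
    by (rule card_crossed_le_length) (use letters set_take_subset[of t ws] in blast)
  then show "card (crossed m (arr t)) \<le> t" using assms by simp
  show "t \<le> card (crossed m (arr t))"
    using assms
  proof (induction rule: inc_induct)
    case base
    have "arr (length ws) = word_perm ws" by (simp add: arr_def)
    then show ?case using full len by simp
  next
    case (step k)
    have "card (crossed m (arr (Suc k))) \<le> Suc (card (crossed m (arr k)))"
      unfolding arr_Suc[OF step.hyps(2)] by (rule card_crossed_transpose_le[OF arr_permutes])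
    then show ?case using step.IH by simp
  qed
qed

lemma crossing_new:
  assumes "t < length ws"
  shows "crossing t \<in> pairs {1..m}" "crossing t \<notin> crossed m (arr t)"
    "crossed m (arr (Suc t)) = insert (crossing t) (crossed m (arr t))"
proof -
  have "arr t (ws ! t) \<noteq> arr t (Suc (ws ! t))"
    using permutes_inj[OF arr_permutes[of t]] by (simp add: inj_eq)
  moreover have "ws ! t \<in> {1..m}" "Suc (ws ! t) \<in> {1..m}" using letter[OF assms] by auto
  ultimately show c: "crossing t \<in> pairs {1..m}"
    unfolding crossing_def pair_in_pairs permutes_in_image[OF arr_permutes[of t]] by blast
  have iff: "s \<in> crossed m (arr (Suc t)) \<longleftrightarrow> (s \<in> crossed m (arr t)) \<noteq> (s = crossing t)"
    if "s \<in> pairs {1..m}" for s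
    unfolding arr_Suc[OF assms] crossing_def by (rule crossed_transpose[OF arr_permutes that])
  show new: "crossing t \<notin> crossed m (arr t)"
  proof
    assume "crossing t \<in> crossed m (arr t)"
    then have "crossed m (arr (Suc t)) \<subseteq> crossed m (arr t)"
      using iff crossed_subset by blast
    then have "card (crossed m (arr (Suc t))) \<le> card (crossed m (arr t))"
      by (intro card_mono) simp_all
    then show False using card_crossed_arr[of t] card_crossed_arr[of "Suc t"] assms by simp
  qed
  show "crossed m (arr (Suc t)) = insert (crossing t) (crossed m (arr t))"
  proof (rule set_eqI)
    fix s
    show "s \<in> crossed m (arr (Suc t)) \<longleftrightarrow> s \<in> insert (crossing t) (crossed m (arr t))"
      using iff[of s] new c crossed_subset[of m "arr t"] crossed_subset[of m "arr (Suc t)"]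
      by (cases "s \<in> pairs {1..m}") blast+
  qed
qed

lemma crossed_arr: "t \<le> length ws \<Longrightarrow> crossed m (arr t) = crossing ` {..<t}"
proof (induction t)
  case 0
  have "arr 0 = id" by (simp add: arr_def)
  then show ?case by (simp only: crossed_id) simp
next
  case (Suc t)
  then show ?case using crossing_new(3)[of t] by (simp add: lessThan_Suc)
qed

lemma bij_crossing: "bij_betw crossing {..<length ws} (pairs {1..m})"
proof -
  have "arr (length ws) = word_perm ws" by (simp add: arr_def)
  then have im: "crossing ` {..<length ws} = pairs {1..m}"
    using crossed_arr[of "length ws"] full by simp
  then have "inj_on crossing {..<length ws}"
    by (intro eq_card_imp_inj_on) (simp_all add: len)
  then show ?thesis using im by (simp add: bij_betw_def)
qed

lemma time_crossing: "t < length ws \<Longrightarrow> time (crossing t) = Suc t"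
  using bij_betw_inv_into_left[OF bij_crossing, of t] by (simp add: time_def)

lemma crossing_cases:
  assumes "s \<in> pairs {1..m}"
  obtains t where "t < length ws" "s = crossing t" "time s = Suc t"
proof -
  have "s \<in> crossing ` {..<length ws}"
    using assms by (simp only: bij_betw_imp_surj_on[OF bij_crossing])
  then show ?thesis using that time_crossing by blast
qed

lemma crossed_arr_iff:
  assumes "s \<in> pairs {1..m}" "t \<le> length ws"
  shows "s \<in> crossed m (arr t) \<longleftrightarrow> time s \<le> t"
proof -
  obtain u where u: "u < length ws" "s = crossing u" "time s = Suc u"
    using assms(1) by (rule crossing_cases)
  have "crossing u \<in> crossing ` {..<t} \<longleftrightarrow> u < t"
    using bij_crossing u(1) assms(2) by (auto simp: bij_betw_def dest: inj_onD)
  then show ?thesis using u crossed_arr[OF assms(2)] by auto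
qed

lemma time_le_iff:
  assumes "a \<in> {1..m}" "b \<in> {1..m}" "a < b" "t \<le> length ws"
  shows "time {a, b} \<le> t \<longleftrightarrow> inv (arr t) b < inv (arr t) a"
  using crossed_arr_iff[of "{a, b}" t] assms by (simp add: pair_in_crossed)

lemma inv_arr_eq: "inv (arr t) a = inv (arr t) b \<longleftrightarrow> a = b"
  using permutes_inj[OF permutes_inv[OF arr_permutes[of t]]] by (simp add: inj_eq)

text \<open>This ties the abstract \<open>under\<close> to the actual heights
  \<open>inv (arr t)\<close>. The letter at index \<open>t\<close> acts at time
  \<open>Suc t\<close>, when \<open>t\<close> letters have acted already.\<close>

lemma under_time:
  assumes "a \<in> {1..m}" "d \<in> {1..m}" "a \<noteq> d" "t \<le> length ws"
  shows "under time (Suc t) d a \<longleftrightarrow> inv (arr t) d < inv (arr t) a"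
proof (cases "d < a")
  case True
  then show ?thesis
    using time_le_iff[of d a t] assms inv_arr_eq[of t a d]
    by (auto simp: under_def insert_commute less_Suc_eq_le)
next
  case False
  then show ?thesis
    using time_le_iff[of a d t] assms by (simp add: under_def less_Suc_eq_le)
qed

lemma bij_time: "bij_betw time (pairs {1..m}) {1..length ws}"
proof -
  have time: "time = Suc \<circ> inv_into {..<length ws} crossing" by (rule ext) (simp only: time_def o_apply)
  have Suc: "bij_betw Suc {..<length ws} {1..length ws}"
    unfolding bij_betw_def by (rule conjI[OF inj_Suc image_Suc_lessThan])
  show ?thesis
    unfolding time by (rule bij_betw_trans[OF bij_betw_inv_into[OF bij_crossing] Suc])
qed

text \<open>If \<open>{a, c}\<close> did not fall between the other two crossings, the heights of
  the three wires would be cyclic just before it or just after it.\<close>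

sublocale wiring "{1..m}" time
proof
  show "inj_on time (pairs {1..m})" by (rule bij_betw_imp_inj_on[OF bij_time])
  fix a b c assume abc: "a \<in> {1..m}" "b \<in> {1..m}" "c \<in> {1..m}" "a < b" "b < c"
  have mem: "{a, b} \<in> pairs {1..m}" "{a, c} \<in> pairs {1..m}" "{b, c} \<in> pairs {1..m}"
    unfolding pair_in_pairs using abc by auto
  have "time {a, c} \<le> length ws"
    using bij_betw_apply[OF bij_time mem(2)] by simp
  then have iff: "time {a, b} \<le> t \<longleftrightarrow> inv (arr t) b < inv (arr t) a"
    "time {a, c} \<le> t \<longleftrightarrow> inv (arr t) c < inv (arr t) a"
    "time {b, c} \<le> t \<longleftrightarrow> inv (arr t) c < inv (arr t) b" if "t \<le> time {a, c}" for t
    using time_le_iff[OF abc(1,2,4), of t] time_le_iff[OF abc(1,3) less_trans[OF abc(4,5)], of t]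
      time_le_iff[OF abc(2,3,5), of t] order_trans[OF that] by blast+
  have "{a, b} \<noteq> {a, c}" "{a, c} \<noteq> {b, c}" using abc by (auto simp: doubleton_eq_iff)
  then have ne: "time {a, b} \<noteq> time {a, c}" "time {a, c} \<noteq> time {b, c}"
    using bij_betw_imp_inj_on[OF bij_time] mem by (auto simp: inj_on_eq_iff)
  have pos: "1 \<le> time {a, c}" using bij_betw_apply[OF bij_time mem(2)] by simp
  have "\<not> (time {a, b} < time {a, c} \<and> time {b, c} < time {a, c})"
  proof
    let ?t = "time {a, c} - 1"
    assume "time {a, b} < time {a, c} \<and> time {b, c} < time {a, c}"
    then have "time {a, b} \<le> ?t" "time {b, c} \<le> ?t" "\<not> time {a, c} \<le> ?t"
      using pos by linarith+
    then have "inv (arr ?t) b < inv (arr ?t) a" "inv (arr ?t) c < inv (arr ?t) b"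
      "\<not> inv (arr ?t) c < inv (arr ?t) a"
      by (simp_all only: iff[OF diff_le_self] not_False_eq_True)
    then show False by linarith
  qed
  moreover have "\<not> (time {a, c} < time {a, b} \<and> time {a, c} < time {b, c})"
  proof
    let ?t = "time {a, c}"
    assume "time {a, c} < time {a, b} \<and> time {a, c} < time {b, c}"
    then have "\<not> time {a, b} \<le> ?t" "\<not> time {b, c} \<le> ?t" "time {a, c} \<le> ?t" by linarith+
    then have "\<not> inv (arr ?t) b < inv (arr ?t) a" "\<not> inv (arr ?t) c < inv (arr ?t) b"
      "inv (arr ?t) c < inv (arr ?t) a"
      by (simp_all only: iff[OF order_refl] not_False_eq_True)
    then show False by linarith
  qed
  ultimately show "time {a, b} < time {a, c} \<and> time {a, c} < time {b, c} \<or>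
      time {b, c} < time {a, c} \<and> time {a, c} < time {a, b}"
    using ne by linarith
qed simp

lemma column_time:
  assumes "s \<in> pairs {1..m}"
  shows "column {1..m} time s = ws ! (time s - 1)"
proof -
  obtain t where t: "t < length ws" "s = crossing t" "time s = Suc t"
    using assms by (rule crossing_cases)
  define i where "i = ws ! t"
  have i: "1 \<le> i" "i < m" using letter[OF t(1)] by (simp_all add: i_def)
  have s: "s = {arr t i, arr t (Suc i)}" by (simp add: t(2) crossing_def i_def)
  have inv_arr: "inv (arr t) (arr t k) = k" for k by (rule permutes_inverses(2)[OF arr_permutes])
  \<comment> \<open>Otherwise the two wires would have crossed before, against
    \<open>crossing_new\<close>.\<close>
  have less: "arr t i < arr t (Suc i)"
  proof (rule ccontr)
    assume "\<not> ?thesis"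
    moreover have "arr t i \<noteq> arr t (Suc i)"
      using permutes_inj[OF arr_permutes[of t]] by (simp add: inj_eq)
    ultimately have *: "arr t (Suc i) < arr t i" by simp
    have "s = {arr t (Suc i), arr t i}" by (simp only: s insert_commute)
    then have "s \<in> crossed m (arr t)"
      using assms pair_in_crossed[OF *, of m "arr t"] by (auto simp: inv_arr)
    then show False using crossing_new(2)[OF t(1)] t(2) by simp
  qed
  have mem: "arr t k \<in> {1..m} \<longleftrightarrow> k \<in> {1..m}" for k by (rule permutes_in_image[OF arr_permutes])
  then have ai: "arr t i \<in> {1..m}" using i by simp
  have "below {1..m} time (Suc t) (arr t i) = arr t ` {1..<i}"
  proof (intro equalityI subsetI)
    fix d assume d: "d \<in> below {1..m} time (Suc t) (arr t i)"
    then have d': "d \<in> {1..m}" "d \<noteq> arr t i" "under time (Suc t) d (arr t i)"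
      by (auto simp: below_def)
    then have "inv (arr t) d < i"
      using under_time[OF ai d'(1) d'(2)[symmetric], of t] t(1) by (simp add: inv_arr)
    moreover have dd: "arr t (inv (arr t) d) = d" by (rule permutes_inverses(1)[OF arr_permutes])
    moreover have "inv (arr t) d \<in> {1..m}" using mem[of "inv (arr t) d"] d'(1) dd by simp
    ultimately show "d \<in> arr t ` {1..<i}" by (intro image_eqI[of _ _ "inv (arr t) d"]) auto
  next
    fix d assume "d \<in> arr t ` {1..<i}"
    then obtain k where k: "k \<in> {1..<i}" "d = arr t k" by blast
    then have "k \<in> {1..m}" "i \<in> {1..m}" using i by auto
    then have "d \<in> {1..m}" "arr t i \<in> {1..m}" unfolding k(2) mem by simp_all
    moreover have "d \<noteq> arr t i"
      using k permutes_inj[OF arr_permutes[of t]] by (simp add: inj_eq)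
    moreover have "under time (Suc t) d (arr t i)"
      using under_time[of "arr t i" d t] calculation t(1) k by (simp add: inv_arr)
    ultimately show "d \<in> below {1..m} time (Suc t) (arr t i)" by (simp add: below_def)
  qed
  then have "card (below {1..m} time (Suc t) (arr t i)) = i - 1"
    using permutes_inj_on[OF arr_permutes[of t]] by (simp add: card_image)
  moreover have "Min s = arr t i" unfolding s by (rule Min_pair[OF less])
  ultimately show ?thesis
    using i by (simp add: column_def height_def t(3) flip: i_def)
qed

text \<open>Without a neighbouring letter in between, the same two wires would cross twice.\<close>

lemma intermediate_letter:
  assumes "t < u" "u < length ws" "ws ! t = ws ! u"
  shows "\<exists>v. t < v \<and> v < u \<and> (ws ! v = Suc (ws ! t) \<or> ws ! t = Suc (ws ! v))"
proof (rule ccontr)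
  assume no: "\<not> ?thesis"
  define i where "i = ws ! t"
  \<comment> \<open>Letters equal to \<open>i\<close> or at distance at least two from it preserve
    the set \<open>{i, Suc i}\<close>, so the same two labels occupy these heights until letter
    \<open>u\<close>.\<close>
  have "v \<le> u \<Longrightarrow> arr v ` {i, Suc i} = arr t ` {i, Suc i}" if "t \<le> v" for v
    using that
  proof (induction rule: dec_induct)
    case (step v)
    have v: "v < length ws" "v < u" using step.prems assms(2) by auto
    have "ws ! v = i \<or> (ws ! v \<noteq> Suc i \<and> i \<noteq> Suc (ws ! v))"
      using no step.hyps v(2) by (cases "v = t") (auto simp: i_def)
    then have "Transposition.transpose (ws ! v) (Suc (ws ! v)) ` {i, Suc i} = {i, Suc i}"
      by (auto simp: Transposition.transpose_def)
    then have "arr (Suc v) ` {i, Suc i} = arr v ` {i, Suc i}"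
      unfolding arr_Suc[OF v(1)] by (simp only: image_comp[symmetric])
    then show ?case using step.IH v by simp
  qed simp
  from this[of u] have "crossing u = crossing t"
    using assms by (simp add: crossing_def i_def)
  then have "u = t"
    using inj_onD[OF bij_betw_imp_inj_on[OF bij_crossing], of u t] assms by simp
  then show False using assms(1) by simp
qed

text \<open>The generating relation links letters that differ by one. Equal letters become
  comparable through the neighbouring letter that occurs between them.\<close>

sublocale wiring_poset "{1..m}" time time "poset_of_word ws"
proof unfold_locales
  let ?P = "poset_of_word ws"
  define G where "G = {(j, k). 1 \<le> j \<and> j < k \<and> k \<le> length ws \<and>
    \<bar>int (ws ! (j - 1)) - int (ws ! (k - 1))\<bar> = 1}"
  have leq: "leq ?P = G\<^sup>* \<inter> {1..length ws} \<times> {1..length ws}"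
    by (simp add: poset_of_word_def G_def)
  show "bij_betw time (pairs {1..m}) (elts ?P)"
    using bij_time by (simp add: poset_of_word_def)
  show "trans (leq ?P)"
    unfolding leq by (rule transI) (auto intro: rtrancl_trans)
  show "col ?P (time s) = column {1..m} time s" if "s \<in> pairs {1..m}" for s
    using column_time[OF that] by (simp add: poset_of_word_def)
  show "time s \<le> time s'" if "(time s, time s') \<in> leq ?P" for s s'
  proof -
    have "(j, k) \<in> G\<^sup>* \<Longrightarrow> j \<le> k" for j k
      by (induction rule: rtrancl_induct) (auto simp: G_def)
    then show ?thesis using that by (auto simp: leq)
  qed
  fix s s' assume s: "s \<in> pairs {1..m}" "s' \<in> pairs {1..m}" "time s \<le> time s'"
    "column {1..m} time s \<le> Suc (column {1..m} time s')"
    "column {1..m} time s' \<le> Suc (column {1..m} time s)"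
  obtain t where t: "t < length ws" "time s = Suc t" using s(1) by (rule crossing_cases)
  obtain u where u: "u < length ws" "time s' = Suc u" using s(2) by (rule crossing_cases)
  have c: "column {1..m} time s = ws ! t" "column {1..m} time s' = ws ! u"
    using column_time s t u by simp_all
  have GI: "(Suc j, Suc k) \<in> G" if "j < k" "k < length ws" "ws ! j = Suc (ws ! k) \<or> ws ! k = Suc (ws ! j)" for j k
    using that by (auto simp: G_def)
  have "(Suc t, Suc u) \<in> G\<^sup>*"
  proof (cases "t = u")
    case False
    then have tu: "t < u" using s(3) t u by simp
    consider "ws ! t = ws ! u" | "ws ! t = Suc (ws ! u) \<or> ws ! u = Suc (ws ! t)"
      using s(4,5) c by linarith
    then show ?thesis
    proof cases
      case 1
      then obtain v where v: "t < v" "v < u" "ws ! v = Suc (ws ! t) \<or> ws ! t = Suc (ws ! v)"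
        using intermediate_letter[OF tu u(1)] by blast
      have "(Suc t, Suc v) \<in> G" "(Suc v, Suc u) \<in> G"
        using GI[of t v] GI[of v u] v u(1) 1 by auto
      then show ?thesis by (meson converse_rtrancl_into_rtrancl r_into_rtrancl)
    next
      case 2
      then show ?thesis using GI tu u(1) by blast
    qed
  qed simp
  then show "(time s, time s') \<in> leq ?P" using t u by (simp add: leq)
qed

end


section \<open>Recovering the word poset from the orientation\<close>

text \<open>After cancelling the common part, equally many elements remain on both sides, and the
  maximum of \<open>A - B\<close> separates them.\<close>

lemma sum_le_sum_if_exchange:
  fixes A B :: "nat set"
  assumes fin: "finite A" "finite B" and card: "card A = card B"
    and less: "\<And>a b. \<lbrakk>a \<in> A - B; b \<in> B - A\<rbrakk> \<Longrightarrow> a \<le> b"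
  shows "\<Sum>A \<le> \<Sum>B"
proof -
  have cd: "card (A - B) = card (B - A)"
    using card card_Int_Diff[OF fin(1), of B] card_Int_Diff[OF fin(2), of A]
    by (simp add: Int_commute)
  have "\<Sum>(A - B) \<le> \<Sum>(B - A)"
  proof (cases "A - B = {}")
    case True
    show ?thesis unfolding True by simp
  next
    case False
    define M where "M = Max (A - B)"
    have fd: "finite (A - B)" using fin(1) by simp
    have M: "M \<in> A - B" "\<And>a. a \<in> A - B \<Longrightarrow> a \<le> M"
      unfolding M_def by (rule Max_in[OF fd False], rule Max_ge[OF fd])
    have "\<Sum>(A - B) \<le> of_nat (card (A - B)) * M"
      by (rule sum_bounded_above) (use M in auto)
    also have "\<dots> = of_nat (card (B - A)) * M" by (simp only: cd)
    also have "\<dots> \<le> \<Sum>(B - A)"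
      by (rule sum_bounded_below) (use less M in auto)
    finally show ?thesis .
  qed
  moreover have "\<Sum>A = \<Sum>(A \<inter> B) + \<Sum>(A - B)" using fin(1) by (rule sum.Int_Diff)
  moreover have "\<Sum>B = \<Sum>(A \<inter> B) + \<Sum>(B - A)"
    unfolding Int_commute[of A] using fin(2) by (rule sum.Int_Diff)
  ultimately show ?thesis by linarith
qed

context wiring
begin

text \<open>If \<open>a\<close> leaves the lower set and \<open>b\<close> enters it, then
  \<open>a\<close> passes from below \<open>b\<close> to above \<open>b\<close>. As wires start in
  label order and cross only once, \<open>a\<close> is the smaller label.\<close>

lemma sum_below_mono:
  assumes "u \<in> W" "u' \<in> W" "t \<le> t'" "card (below W \<tau> t u) = card (below W \<tau> t' u')"
  shows "\<Sum>(below W \<tau> t u) \<le> \<Sum>(below W \<tau> t' u')"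
proof (rule sum_le_sum_if_exchange)
  have below_in_out: "under \<tau> r a b"
    if "a \<in> below W \<tau> r v" "b \<in> W" "b \<notin> below W \<tau> r v" "v \<in> W" for a b r v
  proof (cases "b = v")
    case True
    then show ?thesis using that by (simp add: below_def)
  next
    case False
    then have "under \<tau> r v b" using that under_flip[of b v \<tau> r] by (auto simp: below_def)
    then show ?thesis using that False under_trans[of a v b r] by (auto simp: below_def)
  qed
  fix a b assume a: "a \<in> below W \<tau> t u - below W \<tau> t' u'" and b: "b \<in> below W \<tau> t' u' - below W \<tau> t u"
  then have W: "a \<in> W" "b \<in> W" by (auto simp: below_def)
  have "under \<tau> t a b" "under \<tau> t' b a"
    using a b W assms(1,2) below_in_out[of a t u b] below_in_out[of b t' u' a] by blast+
  then show "a \<le> b"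
    using assms(3) by (auto simp: under_def insert_commute)
qed (use assms(4) in simp_all)

text \<open>The wires below a fixed height form a set whose label sum never decreases in time, since each
  crossing lifts the smaller label. Hence the sums tell which of two crossings in adjacent columns
  comes first.\<close>

lemma adjacent_column_order:
  assumes s: "s \<in> pairs W" and s': "s' \<in> pairs W" and col: "column W \<tau> s' = Suc (column W \<tau> s)"
  shows "\<tau> s < \<tau> s' \<longleftrightarrow>
    \<Sum>(below W \<tau> (\<tau> s) (Min s)) + Max s \<le> \<Sum>(below W \<tau> (\<tau> s') (Min s'))"
proof -
  obtain a b where ab: "a \<in> W" "b \<in> W" "a < b" "s = {a, b}" using s by (rule pairsE)
  obtain c d where cd: "c \<in> W" "d \<in> W" "c < d" "s' = {c, d}" using s' by (rule pairsE)
  let ?B = "below W \<tau> (\<tau> s) a"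
  have mm: "Min s = a" "Max s = b" "Min s' = c" using ab cd by simp_all
  have nB: "a \<notin> ?B" "b \<notin> ?B" using ab by (auto simp: below_def under_def insert_commute)
  have card: "card (below W \<tau> (\<tau> s') c) = Suc (card ?B)"
    using col by (simp add: column_def height_def mm)
  \<comment> \<open>The wires at the lowest \<open>column W \<tau> s\<close> heights are
    \<open>insert a ?B\<close> just before \<open>s\<close> and \<open>insert b ?B\<close> just
    after it. As \<open>a < b\<close>, the label sum jumps there, and the bound in the statement is
    its value after the jump.\<close>
  have after: "below W \<tau> (Suc (\<tau> s)) a = insert b ?B"
  proof (rule set_eqI)
    fix x
    show "x \<in> below W \<tau> (Suc (\<tau> s)) a \<longleftrightarrow> x \<in> insert b ?B"
    proof (cases "x \<in> W - {a, b}")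
      case True
      then have "\<tau> {a, x} \<noteq> \<tau> s"
        using inj_onD[OF inj, of "{a, x}" s] s ab by (auto simp: doubleton_eq_iff)
      then show ?thesis using True by (auto simp: below_def under_def)
    qed (use ab in \<open>auto simp: below_def under_def\<close>)
  qed
  have before: "below W \<tau> (\<tau> s) b = insert a ?B"
    using below_upper ab by simp
  show ?thesis
  proof
    assume "\<tau> s < \<tau> s'"
    then have "\<Sum>(below W \<tau> (Suc (\<tau> s)) a) \<le> \<Sum>(below W \<tau> (\<tau> s') c)"
      using nB card by (intro sum_below_mono ab(1) cd(1)) (simp_all add: after)
    then show "\<Sum>(below W \<tau> (\<tau> s) (Min s)) + Max s \<le> \<Sum>(below W \<tau> (\<tau> s') (Min s'))"
      using nB by (simp add: after mm)
  next
    assume *: "\<Sum>(below W \<tau> (\<tau> s) (Min s)) + Max s \<le> \<Sum>(below W \<tau> (\<tau> s') (Min s'))"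
    show "\<tau> s < \<tau> s'"
    proof (rule ccontr)
      assume "\<not> \<tau> s < \<tau> s'"
      then have "\<Sum>(below W \<tau> (\<tau> s') c) \<le> \<Sum>(below W \<tau> (\<tau> s) b)"
        using nB card by (intro sum_below_mono ab(2) cd(1)) (simp_all add: before)
      then show False using * nB ab(3) by (simp add: before mm)
    qed
  qed
qed

end

text \<open>At the crossing of \<open>a\<close> and \<open>b\<close>, the side of a third wire is
  decided by comparing two crossings on \<open>a\<close>.\<close>

lemma below_cong_orientation:
  assumes "wiring W \<tau>" "wiring W \<tau>'" "same_orientation W \<tau> \<tau>'" "s \<in> pairs W"
  shows "below W \<tau> (\<tau> s) (Min s) = below W \<tau>' (\<tau>' s) (Min s)"
proof -
  obtain a b where ab: "a \<in> W" "b \<in> W" "a < b" "s = {a, b}" using assms(4) by (rule pairsE)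
  show ?thesis
    using ab same_orientation_common_wire[OF assms(1-3), of a _ b]
    by (auto simp: below_def under_def)
qed

lemma column_cong_orientation:
  "\<lbrakk>wiring W \<tau>; wiring W \<tau>'; same_orientation W \<tau> \<tau>'; s \<in> pairs W\<rbrakk> \<Longrightarrow>
    column W \<tau> s = column W \<tau>' s"
  by (simp add: column_def height_def below_cong_orientation)

lemma same_orientation_sym: "same_orientation W \<tau> \<tau>' \<Longrightarrow> same_orientation W \<tau>' \<tau>"
  by (simp add: same_orientation_def)

lemma adjacent_column_order_cong:
  assumes \<tau>: "wiring W \<tau>" and \<tau>': "wiring W \<tau>'" and same: "same_orientation W \<tau> \<tau>'"
    and s: "s \<in> pairs W" "s' \<in> pairs W"
    and col: "column W \<tau> s' = Suc (column W \<tau> s) \<or> column W \<tau> s = Suc (column W \<tau> s')"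
    and less: "\<tau> s < \<tau> s'"
  shows "\<tau>' s < \<tau>' s'"
proof -
  interpret A: wiring W \<tau> by fact
  interpret B: wiring W \<tau>' by fact
  have order: "\<tau> u < \<tau> v \<longleftrightarrow> \<tau>' u < \<tau>' v"
    if "u \<in> pairs W" "v \<in> pairs W" "column W \<tau> v = Suc (column W \<tau> u)" for u v
  proof -
    have "column W \<tau>' v = Suc (column W \<tau>' u)"
      using that column_cong_orientation[OF \<tau> \<tau>' same] by simp
    then show ?thesis
      unfolding A.adjacent_column_order[OF that]
        below_cong_orientation[OF \<tau> \<tau>' same that(1)] below_cong_orientation[OF \<tau> \<tau>' same that(2)]
      by (rule B.adjacent_column_order[OF that(1,2), symmetric])
  qed
  have "s \<noteq> s'" using less by auto
  then have ne: "\<tau>' s \<noteq> \<tau>' s'" using inj_onD[OF B.inj, of s s'] s by auto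
  from col show ?thesis
  proof
    assume "column W \<tau> s' = Suc (column W \<tau> s)"
    then show ?thesis using order[OF s] less by simp
  next
    assume "column W \<tau> s = Suc (column W \<tau> s')"
    then show ?thesis using order[OF s(2,1)] less ne by simp
  qed
qed

text \<open>Generating relations join adjacent columns, where the orientation determines which
  crossing is earlier, so a path of such relations carries over step by step.\<close>

lemma poset_of_word_leq_transfer:
  assumes "longest_word m ws" "longest_word m ws'"
    and same: "same_orientation {1..m} (longest_word.time ws) (longest_word.time ws')"
    and s: "s \<in> pairs {1..m}" "s' \<in> pairs {1..m}"
    and leq: "(longest_word.time ws s, longest_word.time ws s') \<in> leq (poset_of_word ws)"
  shows "(longest_word.time ws' s, longest_word.time ws' s') \<in> leq (poset_of_word ws')"
proof -
  interpret A: longest_word m ws by fact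
  interpret B: longest_word m ws' by fact
  define G where "G = {(j, k). 1 \<le> j \<and> j < k \<and> k \<le> length ws \<and>
    \<bar>int (ws ! (j - 1)) - int (ws ! (k - 1))\<bar> = 1}"
  have "(A.time s, A.time s') \<in> G\<^sup>*"
    using leq by (simp add: poset_of_word_def G_def)
  moreover have "\<forall>v \<in> pairs {1..m}. k = A.time v \<longrightarrow> (B.time s, B.time v) \<in> leq (poset_of_word ws')"
    if "(A.time s, k) \<in> G\<^sup>*" for k
    using that
  proof (induction rule: rtrancl_induct)
    case base
    show ?case
    proof (intro ballI impI)
      fix v assume v: "v \<in> pairs {1..m}" "A.time s = A.time v"
      then have "v = s" using inj_onD[OF A.inj, of v s] s by simp
      then show "(B.time s, B.time v) \<in> leq (poset_of_word ws')" using B.leqI[of s s] s by simp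
    qed
  next
    case (step j k)
    show ?case
    proof (intro ballI impI)
      fix v assume v: "v \<in> pairs {1..m}" "k = A.time v"
      have "j \<in> A.time ` pairs {1..m}"
        using step.hyps(2) bij_betw_imp_surj_on[OF A.bij_time] by (simp add: G_def)
      then obtain u where u: "u \<in> pairs {1..m}" "j = A.time u" by blast
      have less: "A.time u < A.time v"
        using step.hyps(2) u v by (simp add: G_def)
      have adj: "column {1..m} A.time v = Suc (column {1..m} A.time u) \<or>
          column {1..m} A.time u = Suc (column {1..m} A.time v)"
        using step.hyps(2) unfolding A.column_time[OF u(1)] A.column_time[OF v(1)] u(2) v(2) G_def
        by auto
      have "B.time u < B.time v"
        by (rule adjacent_column_order_cong[OF A.wiring_axioms B.wiring_axioms same u(1) v(1) adj less])
      then have "(B.time u, B.time v) \<in> leq (poset_of_word ws')"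
        using B.leqI[OF u(1) v(1)] adj
          column_cong_orientation[OF A.wiring_axioms B.wiring_axioms same] u(1) v(1) by auto
      then show "(B.time s, B.time v) \<in> leq (poset_of_word ws')"
        using step.IH u transD[OF B.trans_leq] by blast
    qed
  qed
  ultimately show ?thesis using s by blast
qed

lemma poset_of_word_iso:
  assumes A: "longest_word m ws" and B: "longest_word m ws'"
    and same: "same_orientation {1..m} (longest_word.time ws) (longest_word.time ws')"
  shows "poset_of_word ws \<sim> poset_of_word ws'"
proof -
  interpret A: longest_word m ws by fact
  interpret B: longest_word m ws' by fact
  let ?i = "inv_into (pairs {1..m}) A.time"
  have bij: "bij_betw (B.time \<circ> ?i) (elts (poset_of_word ws)) (elts (poset_of_word ws'))"
    by (rule bij_betw_trans[OF bij_betw_inv_into[OF A.bij] B.bij])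
  have surj: "\<exists>s \<in> pairs {1..m}. x = A.time s \<and> ?i x = s" if "x \<in> elts (poset_of_word ws)" for x
    using bij_betw_inv_into_right[OF A.bij that, symmetric]
      bij_betw_apply[OF bij_betw_inv_into[OF A.bij] that] by blast
  show ?thesis
    unfolding wp_iso_def
  proof (intro exI[of _ "B.time \<circ> ?i"] conjI bij ballI)
    fix x y assume "x \<in> elts (poset_of_word ws)" "y \<in> elts (poset_of_word ws)"
    then obtain s s' where s: "s \<in> pairs {1..m}" "x = A.time s" "?i x = s"
      "s' \<in> pairs {1..m}" "y = A.time s'" "?i y = s'" using surj by metis
    show "(x, y) \<in> leq (poset_of_word ws) \<longleftrightarrow>
        ((B.time \<circ> ?i) x, (B.time \<circ> ?i) y) \<in> leq (poset_of_word ws')"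
      unfolding o_apply s(3,6) unfolding s(2,5)
      using poset_of_word_leq_transfer[OF A B same s(1,4)]
        poset_of_word_leq_transfer[OF B A same_orientation_sym[OF same] s(1,4)] by blast
  next
    fix x assume "x \<in> elts (poset_of_word ws)"
    then obtain s where s: "s \<in> pairs {1..m}" "x = A.time s" "?i x = s" using surj by metis
    show "col (poset_of_word ws') ((B.time \<circ> ?i) x) = col (poset_of_word ws) x"
      unfolding o_apply s(3) unfolding s(2)
      using A.col_e[OF s(1)] B.col_e[OF s(1)]
        column_cong_orientation[OF A.wiring_axioms B.wiring_axioms same s(1)] by simp
  qed
qed

section \<open>Transport along isomorphisms of word posets\<close>

lemma wp_iso_sym: "P \<sim> Q \<Longrightarrow> Q \<sim> P"
proof -
  assume "P \<sim> Q"
  then obtain \<phi> where \<phi>: "bij_betw \<phi> (elts P) (elts Q)"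
    "\<And>x y. \<lbrakk>x \<in> elts P; y \<in> elts P\<rbrakk> \<Longrightarrow> (x, y) \<in> leq P \<longleftrightarrow> (\<phi> x, \<phi> y) \<in> leq Q"
    "\<And>x. x \<in> elts P \<Longrightarrow> col Q (\<phi> x) = col P x"
    unfolding wp_iso_def by blast
  let ?\<psi> = "inv_into (elts P) \<phi>"
  have inv: "?\<psi> y \<in> elts P" "\<phi> (?\<psi> y) = y" if "y \<in> elts Q" for y
    using bij_betw_apply[OF bij_betw_inv_into[OF \<phi>(1)] that] bij_betw_inv_into_right[OF \<phi>(1) that]
    by simp_all
  show "Q \<sim> P"
    unfolding wp_iso_def
    by (intro exI[of _ ?\<psi>] conjI bij_betw_inv_into[OF \<phi>(1)] ballI)
      (simp_all add: \<phi>(2) inv flip: \<phi>(3))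
qed

lemma wp_iso_trans: "\<lbrakk>P \<sim> Q; Q \<sim> R\<rbrakk> \<Longrightarrow> P \<sim> R"
proof -
  assume "P \<sim> Q" "Q \<sim> R"
  then obtain \<phi> \<psi> where \<phi>: "bij_betw \<phi> (elts P) (elts Q)"
    "\<And>x y. \<lbrakk>x \<in> elts P; y \<in> elts P\<rbrakk> \<Longrightarrow> (x, y) \<in> leq P \<longleftrightarrow> (\<phi> x, \<phi> y) \<in> leq Q"
    "\<And>x. x \<in> elts P \<Longrightarrow> col Q (\<phi> x) = col P x"
    and \<psi>: "bij_betw \<psi> (elts Q) (elts R)"
    "\<And>x y. \<lbrakk>x \<in> elts Q; y \<in> elts Q\<rbrakk> \<Longrightarrow> (x, y) \<in> leq Q \<longleftrightarrow> (\<psi> x, \<psi> y) \<in> leq R"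
    "\<And>x. x \<in> elts Q \<Longrightarrow> col R (\<psi> x) = col Q x"
    unfolding wp_iso_def by blast
  have mem: "\<phi> x \<in> elts Q" if "x \<in> elts P" for x by (rule bij_betw_apply[OF \<phi>(1) that])
  show "P \<sim> R"
    unfolding wp_iso_def
    by (intro exI[of _ "\<psi> \<circ> \<phi>"] conjI bij_betw_trans[OF \<phi>(1) \<psi>(1)] ballI)
      (simp_all add: \<phi>(2,3) \<psi>(2,3) mem)
qed

lemma wiring_poset_iso:
  assumes Q: "wiring_poset W \<tau> e Q" and P: "word_poset P" and "P \<sim> Q"
  obtains e' where "wiring_poset W \<tau> e' P"
proof -
  interpret wiring_poset W \<tau> e Q by fact
  obtain \<phi> where \<phi>: "bij_betw \<phi> (elts Q) (elts P)"
    "\<And>x y. \<lbrakk>x \<in> elts Q; y \<in> elts Q\<rbrakk> \<Longrightarrow> (x, y) \<in> leq Q \<longleftrightarrow> (\<phi> x, \<phi> y) \<in> leq P"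
    "\<And>x. x \<in> elts Q \<Longrightarrow> col P (\<phi> x) = col Q x"
    using wp_iso_sym[OF \<open>P \<sim> Q\<close>] unfolding wp_iso_def by blast
  have mem: "e s \<in> elts Q" if "s \<in> pairs W" for s by (rule bij_betw_apply[OF bij that])
  have "wiring_poset W \<tau> (\<phi> \<circ> e) P"
  proof unfold_locales
    show "bij_betw (\<phi> \<circ> e) (pairs W) (elts P)" by (rule bij_betw_trans[OF bij \<phi>(1)])
    show "trans (leq P)"
      using P by (simp add: word_poset_def partial_order_on_def preorder_on_def)
  qed (use mem \<phi>(2,3) col_e leq_imp leqI in simp_all)
  then show ?thesis by (rule that)
qed

theorem theorem5p1:
  fixes n :: nat and P :: "'a word_poset" and Q :: "'b word_poset"
  assumes "1 \<le> n"
    and "P \<in> word_posets (n + 1) (longest_perm (n + 1))"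
    and "Q \<in> word_posets (n + 1) (longest_perm (n + 1))"
    and "\<And>\<delta>. length \<delta> = n - 1 \<Longrightarrow> ind_seq n \<delta> P = ind_seq n \<delta> Q"
  shows "P \<sim> Q"
proof -
  obtain u where u: "word_poset P" "u \<in> reduced_words (n + 1) (longest_perm (n + 1))" "P \<sim> poset_of_word u"
    using assms(2) unfolding word_posets_def by blast
  obtain v where v: "word_poset Q" "v \<in> reduced_words (n + 1) (longest_perm (n + 1))" "Q \<sim> poset_of_word v"
    using assms(3) unfolding word_posets_def by blast
  interpret A: longest_word "n + 1" u by (rule longest_word_if_reduced[OF u(2)])
  interpret B: longest_word "n + 1" v by (rule longest_word_if_reduced[OF v(2)])
  obtain e where e: "wiring_poset {1..n + 1} A.time e P"
    by (rule wiring_poset_iso[OF A.wiring_poset_axioms u(1,3)])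
  obtain e' where e': "wiring_poset {1..n + 1} B.time e' Q"
    by (rule wiring_poset_iso[OF B.wiring_poset_axioms v(1,3)])
  have "same_orientation {1..n + 1} A.time B.time"
    by (rule same_orientation_if_ind_seq_eq[OF e e' _ assms(1,4)]) simp_all
  then have "poset_of_word u \<sim> poset_of_word v"
    by (rule poset_of_word_iso[OF A.longest_word_axioms B.longest_word_axioms])
  then show ?thesis
    by (rule wp_iso_trans[OF u(3) wp_iso_trans[OF _ wp_iso_sym[OF v(3)]]])
qed

end
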